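(* Let $\Gamma>0$ and $r>2$. There exists a constant $C=C(r,\Gamma)>0$ such that for all $\mathrm{Ra},\mathrm{Pr}>0$, all $L_s\in(0,\infty]$, every solution $(u,p,T)$ of the Rayleigh–Bénard system described in the context, with $p$ normalized to have zero spatial mean over $\Omega$, and every time $t>0$, $$\|p\|_{H^1}\le C\left(\frac{1}{L_s}\|\partial_2u\|_{L^2}+\frac{1}{\mathrm{Pr}}\|\omega\|_{L^2}\|\omega\|_{L^r}+\mathrm{Ra}\,\|T\|_{L^2}\right),$$ where $\omega=\partial_1u_2-\partial_2u_1$ is the vorticity and all functions are evaluated at time $t$.
   Context: Let $\Omega=[0,\Gamma]\times[0,1]$ with coordinates $\mathbf{x}=(x_1,x_2)$ and let $e_2$ be the unit vector in the $x_2$ direction. The Rayleigh–Bénard system with parameters $\mathrm{Ra}>0$, $\mathrm{Pr}>0$, $L_s\in(0,\infty]$ is, for velocity $u=(u_1,u_2)(\mathbf{x},t)$, pressure $p(\mathbf{x},t)$ and temperature $T(\mathbf{x},t)$, in $\Omega\times(0,\infty)$, $$\tfrac{1}{\mathrm{Pr}}(\partial_t u+u\cdot\nabla u)-\Delta u+\nabla p=\mathrm{Ra}\,T e_2,\qquad \nabla\cdot u=0,\qquad \partial_t T+u\cdot\nabla T-\Delta T=0,$$ with initial data $u(\cdot,0)=u_0$, $T(\cdot,0)=T_0$, all functions being $\Gamma$-periodic in $x_1$, and boundary conditions $T=0$ at $x_2=1$, $T=1$ at $x_2=0$; $u_2=0$ at $x_2\in\{0,1\}$; $\partial_2u_1=-\frac{1}{L_s}u_1$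 at $x_2=1$ and $\partial_2u_1=\frac{1}{L_s}u_1$ at $x_2=0$ (Navier-slip), where $\frac1{L_s}:=0$ if $L_s=\infty$ (free-slip). A solution means a global-in-time solution, classical for $t>0$, with $u,T$ continuous in time with values in $L^2(\Omega)$ and attaining the initial data at $t=0$. Norms are over $\Omega$: $\|f\|_{L^q}^q=\int_\Omega|f|^q\,dx$ and $\|f\|_{H^1}^2=\int_\Omega|f|^2\,dx+\int_\Omega|\nabla f|^2\,dx$. *)

theory Defs
  imports "HOL-Analysis.Analysis"
begin

definition strip :: "(real \<times> real) set"
  where "strip = UNIV \<times> {0..1}"

definition cell :: "real \<Rightarrow> (real \<times> real) set"
  where "cell \<Gamma> = {0..\<Gamma>} \<times> {0..1}"

text \<open>
  Fields are \<open>\<Gamma>\<close>-periodic functions on the closed strip; they are given as total functions on the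
  plane, but their values off the strip are never used. For this reason the derivative in the
  second variable is taken within \<open>{0..1}\<close> (one-sided on the walls).
\<close>

definition d1 :: "(real \<times> real \<Rightarrow> 'a::real_normed_vector) \<Rightarrow> real \<times> real \<Rightarrow> 'a"
  where "d1 f x = vector_derivative (\<lambda>s. f (s, snd x)) (at (fst x))"

definition d2 :: "(real \<times> real \<Rightarrow> 'a::real_normed_vector) \<Rightarrow> real \<times> real \<Rightarrow> 'a"
  where "d2 f x = vector_derivative (\<lambda>s. f (fst x, s)) (at (snd x) within {0..1})"

definition dt :: "(real \<Rightarrow> real \<times> real \<Rightarrow> 'a::real_normed_vector) \<Rightarrow> real \<Rightarrow> real \<times> real \<Rightarrow> 'a"
  where "dt f t x = vector_derivative (\<lambda>s. f s x) (at t)"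

definition grad :: "(real \<times> real \<Rightarrow> real) \<Rightarrow> real \<times> real \<Rightarrow> real \<times> real"
  where "grad f x = (d1 f x, d2 f x)"

definition laplacian :: "(real \<times> real \<Rightarrow> 'a::real_normed_vector) \<Rightarrow> real \<times> real \<Rightarrow> 'a"
  where "laplacian f x = d1 (d1 f) x + d2 (d2 f) x"

definition divergence :: "(real \<times> real \<Rightarrow> real \<times> real) \<Rightarrow> real \<times> real \<Rightarrow> real"
  where "divergence v x = fst (d1 v x) + snd (d2 v x)"

definition vorticity :: "(real \<times> real \<Rightarrow> real \<times> real) \<Rightarrow> real \<times> real \<Rightarrow> real"
  where "vorticity v x = snd (d1 v x) - fst (d2 v x)"

definition advect ::
    "(real \<times> real \<Rightarrow> real \<times> real) \<Rightarrow> (real \<times> real \<Rightarrow> 'a::real_normed_vector) \<Rightarrow> real \<times> real \<Rightarrow> 'a"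
  where "advect v f x = fst (v x) *\<^sub>R d1 f x + snd (v x) *\<^sub>R d2 f x"

definition Lnorm :: "real \<Rightarrow> real \<Rightarrow> (real \<times> real \<Rightarrow> 'a::real_normed_vector) \<Rightarrow> real"
  where "Lnorm \<Gamma> q f = (LINT x:cell \<Gamma>|lebesgue. norm (f x) powr q) powr (1 / q)"

definition H1norm :: "real \<Rightarrow> (real \<times> real \<Rightarrow> real) \<Rightarrow> real"
  where "H1norm \<Gamma> f =
    sqrt ((LINT x:cell \<Gamma>|lebesgue. \<bar>f x\<bar>\<^sup>2) + (LINT x:cell \<Gamma>|lebesgue. (norm (grad f x))\<^sup>2))"

definition square_integrable :: "real \<Rightarrow> (real \<times> real \<Rightarrow> 'a::real_normed_vector) \<Rightarrow> bool"
  where "square_integrable \<Gamma> f \<longleftrightarrow>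
    set_borel_measurable lebesgue (cell \<Gamma>) f \<and>
    set_integrable lebesgue (cell \<Gamma>) (\<lambda>x. (norm (f x))\<^sup>2)"

definition continuous_in_L2 :: "real \<Rightarrow> (real \<Rightarrow> real \<times> real \<Rightarrow> 'a::real_normed_vector) \<Rightarrow> bool"
  where "continuous_in_L2 \<Gamma> f \<longleftrightarrow>
    (\<forall>t\<ge>0. square_integrable \<Gamma> (f t)) \<and>
    (\<forall>t\<ge>0. ((\<lambda>s. Lnorm \<Gamma> 2 (\<lambda>x. f s x - f t x)) \<longlongrightarrow> 0) (at t within {0..}))"

definition C1_space :: "(real \<Rightarrow> real \<times> real \<Rightarrow> 'a::real_normed_vector) \<Rightarrow> bool"
  where "C1_space f \<longleftrightarrow>
    (\<forall>t>0. \<forall>x\<in>strip.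
      (\<lambda>s. f t (s, snd x)) differentiable (at (fst x)) \<and>
      (\<lambda>s. f t (fst x, s)) differentiable (at (snd x) within {0..1})) \<and>
    continuous_on ({0<..} \<times> strip) (\<lambda>(t, x). f t x) \<and>
    continuous_on ({0<..} \<times> strip) (\<lambda>(t, x). d1 (f t) x) \<and>
    continuous_on ({0<..} \<times> strip) (\<lambda>(t, x). d2 (f t) x)"

definition C2_space :: "(real \<Rightarrow> real \<times> real \<Rightarrow> 'a::real_normed_vector) \<Rightarrow> bool"
  where "C2_space f \<longleftrightarrow>
    C1_space f \<and> C1_space (\<lambda>t. d1 (f t)) \<and> C1_space (\<lambda>t. d2 (f t))"

definition C1_time :: "(real \<Rightarrow> real \<times> real \<Rightarrow> 'a::real_normed_vector) \<Rightarrow> bool"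
  where "C1_time f \<longleftrightarrow>
    (\<forall>t>0. \<forall>x\<in>strip. (\<lambda>s. f s x) differentiable (at t)) \<and>
    continuous_on ({0<..} \<times> strip) (\<lambda>(t, x). dt f t x)"

definition periodic :: "real \<Rightarrow> (real \<Rightarrow> real \<times> real \<Rightarrow> 'a) \<Rightarrow> bool"
  where "periodic \<Gamma> f \<longleftrightarrow> (\<forall>t>0. \<forall>(x1, x2)\<in>strip. f t (x1 + \<Gamma>, x2) = f t (x1, x2))"

definition inv_slip_length :: "ereal \<Rightarrow> real"
  where "inv_slip_length Ls = (if Ls = \<infinity> then 0 else 1 / real_of_ereal Ls)"

definition rayleigh_benard_solution ::
    "real \<Rightarrow> real \<Rightarrow> real \<Rightarrow> ereal \<Rightarrow> (real \<times> real \<Rightarrow> real \<times> real) \<Rightarrow> (real \<times> real \<Rightarrow> real) \<Rightarrow>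
     (real \<Rightarrow> real \<times> real \<Rightarrow> real \<times> real) \<Rightarrow> (real \<Rightarrow> real \<times> real \<Rightarrow> real) \<Rightarrow>
     (real \<Rightarrow> real \<times> real \<Rightarrow> real) \<Rightarrow> bool"
  where "rayleigh_benard_solution \<Gamma> Ra Pr Ls u0 T0 u p T \<longleftrightarrow>
    C1_time u \<and> C2_space u \<and> C1_space p \<and> C1_time T \<and> C2_space T \<and>
    periodic \<Gamma> u \<and> periodic \<Gamma> p \<and> periodic \<Gamma> T \<and>
    continuous_in_L2 \<Gamma> u \<and> continuous_in_L2 \<Gamma> T \<and>
    (AE x in lebesgue. x \<in> cell \<Gamma> \<longrightarrow> u 0 x = u0 x \<and> T 0 x = T0 x) \<and>
    (\<forall>t>0. \<forall>x\<in>strip.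
      (1 / Pr) *\<^sub>R (dt u t x + advect (u t) (u t) x) - laplacian (u t) x + grad (p t) x
        = (Ra * T t x) *\<^sub>R (0, 1) \<and>
      divergence (u t) x = 0 \<and>
      dt T t x + advect (u t) (T t) x - laplacian (T t) x = 0) \<and>
    (\<forall>t>0. \<forall>x1.
      T t (x1, 1) = 0 \<and> T t (x1, 0) = 1 \<and>
      snd (u t (x1, 1)) = 0 \<and> snd (u t (x1, 0)) = 0 \<and>
      fst (d2 (u t) (x1, 1)) = - inv_slip_length Ls * fst (u t (x1, 1)) \<and>
      fst (d2 (u t) (x1, 0)) = inv_slip_length Ls * fst (u t (x1, 0)))"

end

theory Submission
  imports Defs
begin

text \<open>
  The momentum equation is tested with \<open>\<nabla>p\<close>. The pressure is only once differentiable, so there is no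
  Poisson equation to work with; each integration by parts is arranged so that a single derivative
  falls on \<open>p\<close>. With \<open>u = (v, w)\<close> and all norms over one period cell,
  \<open>\<parallel>\<nabla>p\<parallel>\<^sup>2 = \<integral>\<nabla>p \<bullet> \<Delta>u - 1/Pr \<integral>\<nabla>p \<bullet> \<partial>\<^sub>tu - 1/Pr \<integral>\<nabla>p \<bullet> (u \<bullet> \<nabla>)u + Ra \<integral>\<partial>\<^sub>2p T\<close>,
  and each term is at most \<open>\<parallel>\<nabla>p\<parallel>\<close> times a term of the claim; dividing by \<open>\<parallel>\<nabla>p\<parallel>\<close> bounds the gradient
  (\<open>pressure_gradient_bound\<close>), and the Poincare inequality for the mean-free \<open>p\<close> gives the full norm.

  The time derivative drops out because gradients are orthogonal to divergence-free fields that are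
  tangential to the walls (\<open>time_derivative_term_zero\<close>).

  For the viscous term, incompressibility turns \<open>\<Delta>u\<close> into \<open>(- \<partial>\<^sub>2\<omega>, \<partial>\<^sub>1\<omega>)\<close>. Hence \<open>\<integral>\<nabla>p \<bullet> \<Delta>u\<close> is minus the
  integral of the Jacobian of \<open>p\<close> and \<open>\<omega>\<close>, and such an integral sees \<open>\<omega>\<close> only through its values on the
  walls (\<open>integral_jacobian\<close>). By the slip condition these are \<open>\<plusminus> v / L\<^sub>s\<close>, the same as those of
  \<open>(2 x\<^sub>2 - 1) v / L\<^sub>s\<close>, and the Jacobian of \<open>p\<close> with the latter field contains only \<open>v\<close>, \<open>\<partial>\<^sub>2v\<close> and
  \<open>\<partial>\<^sub>1v = - \<partial>\<^sub>2w\<close>, where the undifferentiated \<open>v\<close> takes over the derivative of its factor \<open>\<partial>\<^sub>1p\<close>. This is where \<open>\<parallel>\<partial>\<^sub>2u\<parallel> / L\<^sub>s\<close> comes from (\<open>viscous_term_bound\<close>).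

  For the convective term, a constant \<open>m\<close> may be subtracted from \<open>v\<close> as a coefficient, again by the Jacobian
  identity. Then \<open>\<parallel>((u - (m, 0)) \<bullet> \<nabla>)u\<parallel> \<le> sup \<bar>u - (m, 0)\<bar> \<parallel>\<nabla>u\<parallel>\<close>, where \<open>\<parallel>\<nabla>u\<parallel> = \<parallel>\<omega>\<parallel>\<close>
  (\<open>dirichlet_eq_enstrophy\<close>), and it remains to bound the supremum by the \<open>L\<^sup>r\<close> norm of \<open>\<omega>\<close>
  (\<open>velocity_sup_le_vorticity\<close>). The complex function \<open>f = v - m - \<i> w\<close> satisfies
  \<open>(\<partial>\<^sub>1 + \<i> \<partial>\<^sub>2) f = - \<i> \<omega>\<close>, so it is recovered from \<open>\<omega>\<close> by the Cauchy kernel \<open>1 / z\<close>, which lies in the dual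
  space of \<open>L\<^sup>r\<close> locally exactly because \<open>r > 2\<close>. Points near a wall are handled by an image point: \<open>f\<close> is real on
  the walls, so the Schwarz reflection cancels the boundary integral.
\<close>

section \<open>Continuously differentiable functions on the strip\<close>

abbreviation rect :: "real \<Rightarrow> real \<Rightarrow> (real \<times> real) set"
  where "rect a b \<equiv> cbox (a, 0) (b, 1)"

lemma mem_strip [simp]: "(x, y) \<in> strip \<longleftrightarrow> 0 \<le> y \<and> y \<le> 1"
  by (auto simp: strip_def)

lemma rect_subset_strip: "rect a b \<subseteq> strip"
  by (auto simp: cbox_Pair_eq)

lemma cell_eq_rect: "cell \<Gamma> = rect 0 \<Gamma>"
  by (auto simp: cbox_Pair_eq cell_def)

lemma continuous_on_strip_compose:
  assumes "continuous_on strip f" "continuous_on A g" "continuous_on A h"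
    and "\<And>x. x \<in> A \<Longrightarrow> 0 \<le> h x \<and> h x \<le> 1"
  shows "continuous_on A (\<lambda>x. f (g x, h x))"
  by (rule continuous_on_compose2[OF assms(1)]) (use assms in \<open>auto intro!: continuous_intros\<close>)

lemma integrable_on_rect:
  fixes f :: "real \<times> real \<Rightarrow> 'a::banach"
  assumes "continuous_on strip f"
  shows "f integrable_on rect a b"
  by (rule integrable_continuous[OF continuous_on_subset[OF assms rect_subset_strip]])

lemma integral_rect_iterated:
  fixes f :: "real \<times> real \<Rightarrow> 'a::banach"
  assumes "continuous_on strip f"
  shows "integral (rect a b) f = integral {a..b} (\<lambda>x. integral {0..1} (\<lambda>y. f (x, y)))"
    and "integral (rect a b) f = integral {0..1} (\<lambda>y. integral {a..b} (\<lambda>x. f (x, y)))"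
proof -
  have c: "continuous_on (rect a b) f"
    by (rule continuous_on_subset[OF assms rect_subset_strip])
  show 1: "integral (rect a b) f = integral {a..b} (\<lambda>x. integral {0..1} (\<lambda>y. f (x, y)))"
    using integral_prod_continuous[OF c] by simp
  show "integral (rect a b) f = integral {0..1} (\<lambda>y. integral {a..b} (\<lambda>x. f (x, y)))"
    unfolding 1 using integral_swap_continuous[of a 0 b 1 "\<lambda>x y. f (x, y)"] c
    by simp
qed

lemma continuous_on_integral_y:
  fixes f :: "real \<times> real \<Rightarrow> 'a::banach"
  assumes "continuous_on strip f"
  shows "continuous_on UNIV (\<lambda>x. integral {0..1} (\<lambda>y. f (x, y)))"
proof -
  have "continuous_on (UNIV \<times> cbox 0 1) (\<lambda>(x, y). f (x, y))"
    using assms by (simp add: strip_def)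
  from integral_continuous_on_param[OF this] show ?thesis by simp
qed

lemma continuous_on_integral_x:
  fixes f :: "real \<times> real \<Rightarrow> 'a::banach"
  assumes "continuous_on strip f"
  shows "continuous_on {0..1} (\<lambda>y. integral {a..b} (\<lambda>x. f (x, y)))"
proof -
  have "continuous_on ({0..1} \<times> cbox a b) (\<lambda>(y, x). f (x, y))"
    unfolding case_prod_beta
    by (rule continuous_on_strip_compose[OF assms]) (auto intro!: continuous_intros)
  from integral_continuous_on_param[OF this] show ?thesis by simp
qed

text \<open>
  The partial derivatives are carried as explicit functions, so that products and linear images can be
  differentiated by composing rules. As in the definition of \<open>d2\<close>, the second derivative is one-sided on
  the walls.
\<close>

definition has_partials :: "(real \<times> real \<Rightarrow> 'a::real_normed_vector) \<Rightarrow> (real \<times> real \<Rightarrow> 'a) \<Rightarrow>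
    (real \<times> real \<Rightarrow> 'a) \<Rightarrow> bool"
  where "has_partials f f1 f2 \<longleftrightarrow>
    (\<forall>x. \<forall>y\<in>{0..1}. ((\<lambda>s. f (s, y)) has_vector_derivative f1 (x, y)) (at x) \<and>
      ((\<lambda>s. f (x, s)) has_vector_derivative f2 (x, y)) (at y within {0..1})) \<and>
    continuous_on strip f \<and> continuous_on strip f1 \<and> continuous_on strip f2"

lemma has_partialsD:
  assumes "has_partials f f1 f2"
  shows "y \<in> {0..1} \<Longrightarrow> ((\<lambda>s. f (s, y)) has_vector_derivative f1 (x, y)) (at x)"
    and "y \<in> {0..1} \<Longrightarrow> ((\<lambda>s. f (x, s)) has_vector_derivative f2 (x, y)) (at y within {0..1})"
    and "continuous_on strip f" "continuous_on strip f1" "continuous_on strip f2"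
  using assms by (auto simp: has_partials_def)

lemma has_partialsI:
  assumes "\<And>x y. y \<in> {0..1} \<Longrightarrow> ((\<lambda>s. f (s, y)) has_vector_derivative f1 (x, y)) (at x)"
    and "\<And>x y. y \<in> {0..1} \<Longrightarrow> ((\<lambda>s. f (x, s)) has_vector_derivative f2 (x, y)) (at y within {0..1})"
    and "continuous_on strip f" "continuous_on strip f1" "continuous_on strip f2"
  shows "has_partials f f1 f2"
  using assms by (auto simp: has_partials_def)

lemma has_partials_const: "has_partials (\<lambda>_. c) (\<lambda>_. 0) (\<lambda>_. 0)"
  by (rule has_partialsI) auto

lemma has_partials_diff:
  assumes "has_partials f f1 f2" "has_partials g g1 g2"
  shows "has_partials (\<lambda>z. f z - g z) (\<lambda>z. f1 z - g1 z) (\<lambda>z. f2 z - g2 z)"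
  by (rule has_partialsI)
    (intro has_vector_derivative_diff continuous_on_diff has_partialsD[OF assms(1)] has_partialsD[OF assms(2)]; assumption)+

lemma has_partials_mult:
  fixes f g :: "real \<times> real \<Rightarrow> 'a::real_normed_algebra"
  assumes "has_partials f f1 f2" "has_partials g g1 g2"
  shows "has_partials (\<lambda>z. f z * g z) (\<lambda>z. f z * g1 z + f1 z * g z) (\<lambda>z. f z * g2 z + f2 z * g z)"
  by (rule has_partialsI)
    (intro has_vector_derivative_mult continuous_on_add continuous_on_mult
      has_partialsD[OF assms(1)] has_partialsD[OF assms(2)]; assumption)+

lemma has_partials_bounded_linear:
  assumes "bounded_linear h" "has_partials f f1 f2"
  shows "has_partials (\<lambda>z. h (f z)) (\<lambda>z. h (f1 z)) (\<lambda>z. h (f2 z))"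
  by (rule has_partialsI)
    (intro bounded_linear.has_vector_derivative[OF assms(1)] bounded_linear.continuous_on[OF assms(1)]
      has_partialsD[OF assms(2)]; assumption)+

lemma partials_unique:
  assumes f: "has_partials f f1 f2" and g: "has_partials g g1 g2"
    and eq: "\<And>z. z \<in> strip \<Longrightarrow> f z = g z" and z: "z \<in> strip"
  shows "f1 z = g1 z" "f2 z = g2 z"
proof -
  obtain x y where xy: "z = (x, y)" "y \<in> {0..1}" using z by (cases z) auto
  have "(\<lambda>s. f (s, y)) = (\<lambda>s. g (s, y))" using eq xy by auto
  then show "f1 z = g1 z"
    using has_partialsD(1)[OF f xy(2), of x] has_partialsD(1)[OF g xy(2), of x] xy
    by (auto intro: vector_derivative_unique_at)
  have "((\<lambda>s. f (x, s)) has_vector_derivative g2 (x, y)) (at y within {0..1})"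
    by (rule has_vector_derivative_transform[OF xy(2) _ has_partialsD(2)[OF g xy(2)]])
      (use eq in auto)
  then show "f2 z = g2 z"
    using has_partialsD(2)[OF f xy(2), of x] xy
      vector_derivative_unique_within_closed_interval[of 0 1 y] by auto
qed

lemma has_partials_C1_space:
  assumes "C1_space f" "t > 0"
  shows "has_partials (f t) (d1 (f t)) (d2 (f t))"
proof -
  have c: "continuous_on strip (\<lambda>x. h t x)" if "continuous_on ({0<..} \<times> strip) (\<lambda>(t, x). h t x)"
    for h :: "real \<Rightarrow> real \<times> real \<Rightarrow> 'a"
  proof -
    have "continuous_on strip (\<lambda>x. case (t, x) of (t, x) \<Rightarrow> h t x)"
      by (rule continuous_on_compose2[OF that, of strip "\<lambda>x. (t, x)"])
        (use \<open>t > 0\<close> in \<open>auto intro!: continuous_intros\<close>)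
    then show ?thesis by simp
  qed
  have "(\<lambda>s. f t (s, y)) differentiable (at x) \<and>
      (\<lambda>s. f t (x, s)) differentiable (at y within {0..1})" if "y \<in> {0..1}" for x y
    using assms(1)[unfolded C1_space_def, THEN conjunct1, rule_format, OF assms(2), of "(x, y)"] that
    by simp
  then show ?thesis
    using assms c unfolding has_partials_def C1_space_def d1_def d2_def
    by (auto simp: vector_derivative_works)
qed

definition periodic_x :: "real \<Rightarrow> (real \<times> real \<Rightarrow> 'a) \<Rightarrow> bool"
  where "periodic_x \<Gamma> f \<longleftrightarrow> (\<forall>x. \<forall>y\<in>{0..1}. f (x + \<Gamma>, y) = f (x, y))"

lemma periodic_x_partials:
  assumes "has_partials f f1 f2" "periodic_x \<Gamma> f"
  shows "periodic_x \<Gamma> f1" "periodic_x \<Gamma> f2"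
proof -
  have "f1 (x + \<Gamma>, y) = f1 (x, y)" if y: "y \<in> {0..1}" for x y
  proof -
    have "((\<lambda>s. f (s + \<Gamma>, y)) has_vector_derivative (1 *\<^sub>R f1 (x + \<Gamma>, y))) (at x)"
      by (rule vector_diff_chain_at[of "\<lambda>s. s + \<Gamma>" 1 x "\<lambda>s. f (s, y)", unfolded o_def])
        (use has_partialsD(1)[OF assms(1) y] in \<open>auto intro!: derivative_eq_intros\<close>)
    moreover have "(\<lambda>s. f (s + \<Gamma>, y)) = (\<lambda>s. f (s, y))"
      using assms(2) y by (auto simp: periodic_x_def)
    ultimately show ?thesis
      using has_partialsD(1)[OF assms(1) y, of x] vector_derivative_unique_at by fastforce
  qed
  then show "periodic_x \<Gamma> f1" by (auto simp: periodic_x_def)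
  have "f2 (x + \<Gamma>, y) = f2 (x, y)" if y: "y \<in> {0..1}" for x y
  proof -
    have "((\<lambda>s. f (x, s)) has_vector_derivative f2 (x + \<Gamma>, y)) (at y within {0..1})"
      by (rule has_vector_derivative_transform[OF y _ has_partialsD(2)[OF assms(1) y]])
        (use assms(2) in \<open>auto simp: periodic_x_def\<close>)
    then show ?thesis
      using has_partialsD(2)[OF assms(1) y, of x]
        vector_derivative_unique_within_closed_interval[of 0 1 y] y by auto
  qed
  then show "periodic_x \<Gamma> f2" by (auto simp: periodic_x_def)
qed

lemma periodic_x_of_periodic:
  assumes "periodic \<Gamma> f" "t > 0"
  shows "periodic_x \<Gamma> (f t)"
  using assms unfolding periodic_def periodic_x_def by fastforce

lemma integral_periodic:
  fixes h :: "real \<Rightarrow> real"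
  assumes c: "continuous_on UNIV h" and p: "\<And>x. h (x + \<Gamma>) = h x" and "\<Gamma> > 0"
  shows "integral {a..a + \<Gamma>} h = integral {0..\<Gamma>} h"
proof -
  have i: "h integrable_on {u..v}" for u v
    by (intro integrable_continuous_real continuous_on_subset[OF c]) auto
  have s: "integral {u + \<Gamma>..v + \<Gamma>} h = integral {u..v} h" for u v
    using integral_shift_Icc_real[of u v h \<Gamma>] p by (simp add: add.commute o_def)
  show ?thesis
  proof (cases "a \<ge> 0")
    case True
    have "integral {0..a} h + integral {a..a + \<Gamma>} h = integral {0..a + \<Gamma>} h"
      by (rule Henstock_Kurzweil_Integration.integral_combine) (use True \<open>\<Gamma> > 0\<close> i in auto)
    moreover have "integral {0..\<Gamma>} h + integral {\<Gamma>..a + \<Gamma>} h = integral {0..a + \<Gamma>} h"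
      by (rule Henstock_Kurzweil_Integration.integral_combine) (use True \<open>\<Gamma> > 0\<close> i in auto)
    ultimately show ?thesis using s[of 0 a] by simp
  next
    case False
    have "integral {a..0} h + integral {0..\<Gamma>} h = integral {a..\<Gamma>} h"
      by (rule Henstock_Kurzweil_Integration.integral_combine) (use False \<open>\<Gamma> > 0\<close> i in auto)
    moreover have "integral {a..a + \<Gamma>} h + integral {a + \<Gamma>..\<Gamma>} h = integral {a..\<Gamma>} h"
      by (rule Henstock_Kurzweil_Integration.integral_combine) (use False \<open>\<Gamma> > 0\<close> i in auto)
    ultimately show ?thesis using s[of a 0] by simp
  qed
qed

lemma integral_rect_periodic:
  fixes f :: "real \<times> real \<Rightarrow> real"
  assumes "continuous_on strip f" "periodic_x \<Gamma> f" "\<Gamma> > 0"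
  shows "integral (rect a (a + \<Gamma>)) f = integral (rect 0 \<Gamma>) f"
proof -
  have "integral {a..a + \<Gamma>} (\<lambda>x. f (x, y)) = integral {0..\<Gamma>} (\<lambda>x. f (x, y))" if "y \<in> {0..1}" for y
    by (rule integral_periodic)
      (use assms that in \<open>auto simp: periodic_x_def intro!: continuous_on_strip_compose[OF assms(1)] continuous_intros\<close>)
  then show ?thesis
    unfolding integral_rect_iterated(2)[OF assms(1)] by (intro integral_cong) auto
qed

lemma integral_rect_shift:
  fixes f :: "real \<times> real \<Rightarrow> real"
  assumes "continuous_on strip f" "periodic_x \<Gamma> f" "\<Gamma> > 0"
  shows "integral (rect 0 \<Gamma>) (\<lambda>(x, y). f (x + s, y)) = integral (rect 0 \<Gamma>) f"
proof -
  have c: "continuous_on strip (\<lambda>(x, y). f (x + s, y))"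
    unfolding case_prod_beta
    by (rule continuous_on_strip_compose[OF assms(1)]) (auto intro!: continuous_intros simp: strip_def)
  have "integral (rect 0 \<Gamma>) (\<lambda>(x, y). f (x + s, y)) = integral (rect s (s + \<Gamma>)) f"
    unfolding integral_rect_iterated(2)[OF assms(1)] integral_rect_iterated(2)[OF c]
    using integral_shift_Icc_real[of 0 \<Gamma> "\<lambda>x. f (x, y)" s for y]
    by (simp add: add.commute o_def)
  then show ?thesis using integral_rect_periodic[OF assms] by simp
qed

section \<open>Integration by parts with one derivative on each factor\<close>

lemma integral_partial_x:
  fixes f :: "real \<times> real \<Rightarrow> 'a::banach"
  assumes "has_partials f f1 f2" "a \<le> b"
  shows "integral (rect a b) f1 = integral {0..1} (\<lambda>y. f (b, y) - f (a, y))"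
  unfolding integral_rect_iterated(2)[OF has_partialsD(4)[OF assms(1)]]
proof (rule integral_cong)
  fix y :: real assume y: "y \<in> {0..1}"
  have "((\<lambda>x. f1 (x, y)) has_integral f (b, y) - f (a, y)) {a..b}"
    by (rule fundamental_theorem_of_calculus[OF assms(2)])
      (rule has_vector_derivative_at_within[OF has_partialsD(1)[OF assms(1) y]])
  then show "integral {a..b} (\<lambda>x. f1 (x, y)) = f (b, y) - f (a, y)" by (rule integral_unique)
qed

lemma integral_partial_y:
  fixes f :: "real \<times> real \<Rightarrow> 'a::banach"
  assumes "has_partials f f1 f2"
  shows "integral (rect a b) f2 = integral {a..b} (\<lambda>x. f (x, 1) - f (x, 0))"
  unfolding integral_rect_iterated(1)[OF has_partialsD(5)[OF assms(1)]]
proof (rule integral_cong)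
  fix x
  have "((\<lambda>y. f2 (x, y)) has_integral f (x, 1) - f (x, 0)) {0..1}"
    by (rule fundamental_theorem_of_calculus) (auto intro: has_partialsD(2)[OF assms])
  then show "integral {0..1} (\<lambda>y. f2 (x, y)) = f (x, 1) - f (x, 0)" by (rule integral_unique)
qed

lemma has_partials_shift_derivative:
  assumes "has_partials f f1 f2" "y \<in> {0..1}"
  shows "((\<lambda>s. f (x + c * s, y)) has_vector_derivative c *\<^sub>R f1 (x + c * s, y)) (at s within S)"
proof -
  have "((\<lambda>s. f (s, y)) \<circ> (\<lambda>s. x + c * s) has_vector_derivative c *\<^sub>R f1 (x + c * s, y)) (at s)"
    by (rule vector_diff_chain_at)
      (auto intro!: derivative_eq_intros has_partialsD(1)[OF assms])
  then show ?thesis by (simp add: o_def has_vector_derivative_at_within)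
qed

lemma continuous_on_shift:
  assumes "continuous_on strip f"
  shows "continuous_on (UNIV \<times> rect a b) (\<lambda>w. f (fst (snd w) + c * fst w, snd (snd w)))"
    and "continuous_on strip (\<lambda>z. f (fst z + d, snd z))"
  by (rule continuous_on_strip_compose[OF assms];
      force simp: cbox_Pair_eq strip_def intro: continuous_intros)+

lemma integral_shift_has_derivative:
  fixes k g :: "real \<times> real \<Rightarrow> real"
  assumes k: "continuous_on strip k" and g: "has_partials g g1 g2"
  shows "((\<lambda>s. integral (rect a b) (\<lambda>z. k z * g (fst z + c * s, snd z))) has_vector_derivative
    integral (rect a b) (\<lambda>z. k z * (c * g1 z))) (at 0)"
proof -
  have "((\<lambda>s. integral (rect a b) (\<lambda>z. k z * g (fst z + c * s, snd z))) has_vector_derivative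
    integral (rect a b) (\<lambda>z. k z * (c * g1 (fst z + c * 0, snd z)))) (at 0 within UNIV)"
  proof (rule leibniz_rule_vector_derivative)
    fix s :: real and z :: "real \<times> real" assume "z \<in> rect a b"
    then have "snd z \<in> {0..1}" by (cases z) (auto simp: cbox_Pair_eq)
    from has_partials_shift_derivative[OF g this, of "fst z" c s UNIV]
    show "((\<lambda>s. k z * g (fst z + c * s, snd z)) has_vector_derivative
        k z * (c * g1 (fst z + c * s, snd z))) (at s within UNIV)"
      by (intro has_vector_derivative_mult_right) simp
  next
    fix s
    show "(\<lambda>z. k z * g (fst z + c * s, snd z)) integrable_on rect a b"
      by (intro integrable_on_rect continuous_on_mult k continuous_on_shift(2)[OF has_partialsD(3)[OF g]])
  next
    have "continuous_on (UNIV \<times> rect a b) (\<lambda>w. k (snd w))"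
      by (rule continuous_on_compose2[OF k])
        (use rect_subset_strip in \<open>auto intro!: continuous_intros\<close>)
    then show "continuous_on (UNIV \<times> rect a b) (\<lambda>(s, z). k z * (c * g1 (fst z + c * s, snd z)))"
      unfolding case_prod_beta
      by (intro continuous_on_mult continuous_on_const continuous_on_shift(1)[OF has_partialsD(4)[OF g]])
  qed auto
  then show ?thesis by simp
qed

lemma has_partials_shift:
  assumes "has_partials f f1 f2"
  shows "has_partials (\<lambda>z. f (fst z + d, snd z)) (\<lambda>z. f1 (fst z + d, snd z)) (\<lambda>z. f2 (fst z + d, snd z))"
proof (rule has_partialsI)
  fix x y :: real assume y: "y \<in> {0..1}"
  show "((\<lambda>s. f (fst (s, y) + d, snd (s, y))) has_vector_derivative f1 (fst (x, y) + d, snd (x, y))) (at x)"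
    using has_partials_shift_derivative[OF assms y, of d 1 x UNIV] by (simp add: add.commute)
  show "((\<lambda>s. f (fst (x, s) + d, snd (x, s))) has_vector_derivative f2 (fst (x, y) + d, snd (x, y)))
      (at y within {0..1})"
    using has_partialsD(2)[OF assms y, of "x + d"] by simp
qed (intro continuous_on_shift has_partialsD[OF assms])+

text \<open>
  For smooth functions the integrand is \<open>\<partial>\<^sub>2(\<partial>\<^sub>1p g) - \<partial>\<^sub>1(\<partial>\<^sub>2p g)\<close>, but here \<open>p\<close> need not have second
  derivatives. Instead, \<open>p\<close> is translated by \<open>s\<close> in the periodic direction: the divergence theorem for
  \<open>\<partial>\<^sub>2(p(x + s, y) g(x, y))\<close> needs first derivatives only, and after the translation has been moved to
  \<open>g\<close> in the term that contains \<open>\<partial>\<^sub>2p\<close>, the identity can be differentiated in \<open>s\<close> at \<open>0\<close>.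
\<close>

lemma integral_jacobian:
  fixes p g :: "real \<times> real \<Rightarrow> real"
  assumes \<Gamma>: "\<Gamma> > 0" and p: "has_partials p p1 p2" "periodic_x \<Gamma> p"
    and g: "has_partials g g1 g2" "periodic_x \<Gamma> g"
  shows "integral (rect 0 \<Gamma>) (\<lambda>z. p1 z * g2 z - p2 z * g1 z) =
    integral {0..\<Gamma>} (\<lambda>x. p1 (x, 1) * g (x, 1)) - integral {0..\<Gamma>} (\<lambda>x. p1 (x, 0) * g (x, 0))"
proof -
  let ?I = "integral (rect 0 \<Gamma>)"
  note cp = has_partialsD(3-5)[OF p(1)] and cg = has_partialsD(3-5)[OF g(1)]
  define B where "B s y = integral {0..\<Gamma>} (\<lambda>x. g (x, y) * p (x + s, y))" for s y
  have cx: "continuous_on A (\<lambda>x. h (x + d, y))" if "continuous_on strip h" "0 \<le> y" "y \<le> 1"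
    for h :: "real \<times> real \<Rightarrow> real" and y d :: real and A
    by (rule continuous_on_strip_compose[OF that(1)]) (use that in \<open>auto intro!: continuous_intros\<close>)
  have cx0: "continuous_on A (\<lambda>x. h (x, y))" if "continuous_on strip h" "0 \<le> y" "y \<le> 1"
    for h :: "real \<times> real \<Rightarrow> real" and y :: real and A
    using cx[OF that, of A 0] by simp
  have E: "?I (\<lambda>z. p2 z * g (fst z + (-1) * s, snd z)) + ?I (\<lambda>z. g2 z * p (fst z + 1 * s, snd z))
      = B s 1 - B s 0" for s
  proof -
    note ps = has_partials_shift[OF p(1), of s]
    have "?I (\<lambda>z. g z * p2 (fst z + s, snd z) + g2 z * p (fst z + s, snd z)) =
      integral {0..\<Gamma>} (\<lambda>x. g (x, 1) * p (x + s, 1) - g (x, 0) * p (x + s, 0))"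
      using integral_partial_y[OF has_partials_mult[OF g(1) ps], of 0 \<Gamma>] by simp
    also have "\<dots> = B s 1 - B s 0"
      unfolding B_def by (intro integral_diff integrable_continuous_real continuous_on_mult cx cx0 cp cg) auto
    also have "?I (\<lambda>z. g z * p2 (fst z + s, snd z) + g2 z * p (fst z + s, snd z)) =
      ?I (\<lambda>z. g z * p2 (fst z + s, snd z)) + ?I (\<lambda>z. g2 z * p (fst z + s, snd z))"
      by (intro integral_add integrable_on_rect continuous_on_mult cp cg continuous_on_shift)
    also have "?I (\<lambda>z. g z * p2 (fst z + s, snd z)) = ?I (\<lambda>z. p2 z * g (fst z - s, snd z))"
    proof -
      let ?h = "\<lambda>z. p2 z * g (fst z - s, snd z)"
      have "continuous_on strip ?h"
        using continuous_on_shift(2)[OF cg(1), of "-s"] by (intro continuous_on_mult cp) simp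
      moreover have "periodic_x \<Gamma> ?h"
        using periodic_x_partials(2)[OF p] g(2)
        by (auto simp: periodic_x_def diff_add_eq[symmetric] simp del: diff_add_eq)
      ultimately have "?I (\<lambda>(x, y). ?h (x + s, y)) = ?I ?h"
        by (rule integral_rect_shift[OF _ _ \<Gamma>])
      moreover have "(\<lambda>(x, y). ?h (x + s, y)) = (\<lambda>z. g z * p2 (fst z + s, snd z))"
        by (auto simp: fun_eq_iff)
      ultimately show ?thesis by simp
    qed
    finally show ?thesis by simp
  qed
  have dB: "((\<lambda>s. B s y) has_vector_derivative integral {0..\<Gamma>} (\<lambda>x. g (x, y) * p1 (x, y))) (at 0)"
    if y: "y \<in> {0..1}" for y
  proof -
    have "((\<lambda>s. integral (cbox 0 \<Gamma>) (\<lambda>x. g (x, y) * p (x + s, y))) has_vector_derivative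
        integral (cbox 0 \<Gamma>) (\<lambda>x. g (x, y) * p1 (x + 0, y))) (at 0 within UNIV)"
    proof (rule leibniz_rule_vector_derivative)
      fix s x :: real
      show "((\<lambda>s. g (x, y) * p (x + s, y)) has_vector_derivative g (x, y) * p1 (x + s, y)) (at s within UNIV)"
        using has_partials_shift_derivative[OF p(1) y, of x 1 s UNIV]
        by (intro has_vector_derivative_mult_right) simp
      show "(\<lambda>x. g (x, y) * p (x + s, y)) integrable_on cbox 0 \<Gamma>"
        unfolding cbox_interval using y
        by (intro integrable_continuous_real continuous_on_mult cx cx0 cp cg) auto
    next
      show "continuous_on (UNIV \<times> cbox 0 \<Gamma>) (\<lambda>(s, x). g (x, y) * p1 (x + s, y))"
        unfolding case_prod_beta using y
        by (intro continuous_on_mult continuous_on_strip_compose[OF cg(1)] continuous_on_strip_compose[OF cp(2)])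
          (auto intro!: continuous_intros)
    qed auto
    then show ?thesis by (simp add: B_def)
  qed
  let ?D = "?I (\<lambda>z. p2 z * ((-1) * g1 z)) + ?I (\<lambda>z. g2 z * (1 * p1 z))"
  have "((\<lambda>s. B s 1 - B s 0) has_vector_derivative ?D) (at 0)"
    unfolding E[symmetric]
    by (intro has_vector_derivative_add integral_shift_has_derivative[OF cp(3) g(1)]
        integral_shift_has_derivative[OF cg(3) p(1)])
  moreover have "((\<lambda>s. B s 1 - B s 0) has_vector_derivative
      integral {0..\<Gamma>} (\<lambda>x. g (x, 1) * p1 (x, 1)) - integral {0..\<Gamma>} (\<lambda>x. g (x, 0) * p1 (x, 0))) (at 0)"
    by (intro has_vector_derivative_diff dB) auto
  ultimately have "?D = integral {0..\<Gamma>} (\<lambda>x. g (x, 1) * p1 (x, 1)) - integral {0..\<Gamma>} (\<lambda>x. g (x, 0) * p1 (x, 0))"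
    by (rule vector_derivative_unique_at)
  moreover have "?D = ?I (\<lambda>z. p1 z * g2 z - p2 z * g1 z)"
    by (subst integral_add[symmetric])
      (auto intro!: integrable_on_rect continuous_on_mult cp cg continuous_on_minus simp: mult.commute)
  ultimately show ?thesis by (simp add: mult.commute)
qed

lemma integral_by_parts_x:
  fixes p v :: "real \<times> real \<Rightarrow> real"
  assumes \<Gamma>: "\<Gamma> > 0" and p: "has_partials p p1 p2" "periodic_x \<Gamma> p"
    and v: "has_partials v v1 v2" "periodic_x \<Gamma> v"
  shows "integral (rect 0 \<Gamma>) (\<lambda>z. p1 z * v z) = - integral (rect 0 \<Gamma>) (\<lambda>z. p z * v1 z)"
proof -
  let ?I = "integral (rect 0 \<Gamma>)"
  note c = has_partialsD(3-5)[OF p(1)] has_partialsD(3-5)[OF v(1)]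
  have "?I (\<lambda>z. p z * v1 z) + ?I (\<lambda>z. p1 z * v z) = ?I (\<lambda>z. p z * v1 z + p1 z * v z)"
    by (intro integral_add[symmetric] integrable_on_rect continuous_on_mult c)
  also have "\<dots> = integral {0..1} (\<lambda>y. p (\<Gamma>, y) * v (\<Gamma>, y) - p (0, y) * v (0, y))"
    using integral_partial_x[OF has_partials_mult[OF p(1) v(1)], of 0 \<Gamma>] \<Gamma> by simp
  also have "\<dots> = integral {0..1} (\<lambda>y::real. 0::real)"
  proof (rule integral_cong)
    fix y :: real assume "y \<in> {0..1}"
    then have "p (0 + \<Gamma>, y) = p (0, y)" "v (0 + \<Gamma>, y) = v (0, y)"
      using p(2) v(2) unfolding periodic_x_def by blast+
    then show "p (\<Gamma>, y) * v (\<Gamma>, y) - p (0, y) * v (0, y) = 0" by simp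
  qed
  finally show ?thesis by simp
qed

lemma integral_grad_orthogonal:
  fixes p v w :: "real \<times> real \<Rightarrow> real"
  assumes \<Gamma>: "\<Gamma> > 0" and p: "has_partials p p1 p2" "periodic_x \<Gamma> p"
    and v: "has_partials v v1 v2" "periodic_x \<Gamma> v" and w: "has_partials w w1 w2"
    and div: "\<And>z. z \<in> strip \<Longrightarrow> v1 z + w2 z = 0"
    and wall: "\<And>x. w (x, 0) = 0" "\<And>x. w (x, 1) = 0"
  shows "integral (rect 0 \<Gamma>) (\<lambda>z. p1 z * v z + p2 z * w z) = 0"
proof -
  let ?I = "integral (rect 0 \<Gamma>)"
  note cs = has_partialsD(3-5)[OF p(1)] has_partialsD(3-5)[OF v(1)] has_partialsD(3-5)[OF w]
  have "?I (\<lambda>z. p z * w2 z + p2 z * w z) = 0"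
    using integral_partial_y[OF has_partials_mult[OF p(1) w], of 0 \<Gamma>] by (simp add: wall)
  also have "?I (\<lambda>z. p z * w2 z + p2 z * w z) = ?I (\<lambda>z. - (p z * v1 z) + p2 z * w z)"
  proof (rule integral_cong)
    fix z assume "z \<in> rect 0 \<Gamma>"
    then have "v1 z + w2 z = 0" using div rect_subset_strip by blast
    then have "w2 z = - v1 z" by simp
    then show "p z * w2 z + p2 z * w z = - (p z * v1 z) + p2 z * w z" by simp
  qed
  also have "\<dots> = ?I (\<lambda>z. - (p z * v1 z)) + ?I (\<lambda>z. p2 z * w z)"
    by (intro integral_add integrable_on_rect continuous_intros cs)
  also have "?I (\<lambda>z. - (p z * v1 z)) = ?I (\<lambda>z. p1 z * v z)"
    by (simp add: integral_by_parts_x[OF \<Gamma> p v])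
  also have "?I (\<lambda>z. p1 z * v z) + ?I (\<lambda>z. p2 z * w z) = ?I (\<lambda>z. p1 z * v z + p2 z * w z)"
    by (intro integral_add[symmetric] integrable_on_rect continuous_intros cs)
  finally show ?thesis .
qed

text \<open>
  Both derivatives are compared through \<open>f2 (b, y) - f2 (x, y) = \<integral> f12 (s, y) ds\<close>, which is the fundamental
  theorem of calculus for \<open>\<lambda>x. f (x, y)\<close> differentiated in \<open>y\<close> under the integral. The argument stays inside the
  closed strip and so also covers the walls.
\<close>

lemma mixed_partials_commute:
  fixes f :: "real \<times> real \<Rightarrow> 'a::banach"
  assumes f: "has_partials f f1 f2" and f1: "has_partials f1 f11 f12" and f2: "has_partials f2 f21 f22"
    and y: "y \<in> {0..1}"
  shows "f12 (x, y) = f21 (x, y)"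
proof -
  have eq: "f2 (b, y) - f2 (x, y) = integral {x..b} (\<lambda>s. f12 (s, y))" if "x \<le> b" for b
  proof -
    have "((\<lambda>y. integral (cbox x b) (\<lambda>s. f1 (s, y))) has_vector_derivative
        integral (cbox x b) (\<lambda>s. f12 (s, y))) (at y within {0..1})"
    proof (rule leibniz_rule_vector_derivative)
      fix y s :: real assume "y \<in> {0..1}"
      then show "((\<lambda>y. f1 (s, y)) has_vector_derivative f12 (s, y)) (at y within {0..1})"
        by (rule has_partialsD(2)[OF f1])
    next
      fix y :: real assume "y \<in> {0..1}"
      then show "(\<lambda>s. f1 (s, y)) integrable_on cbox x b"
        unfolding cbox_interval
        by (intro integrable_continuous_real continuous_on_strip_compose[OF has_partialsD(3)[OF f1]])
          (auto intro!: continuous_intros)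
    next
      show "continuous_on ({0..1} \<times> cbox x b) (\<lambda>(y, s). f12 (s, y))"
        unfolding case_prod_beta
        by (rule continuous_on_strip_compose[OF has_partialsD(5)[OF f1]])
          (auto intro!: continuous_intros)
    qed (use y in auto)
    moreover have "integral (cbox x b) (\<lambda>s. f1 (s, y)) = f (b, y) - f (x, y)" if "y \<in> {0..1}" for y
      unfolding cbox_interval
      by (rule integral_unique, rule fundamental_theorem_of_calculus[OF \<open>x \<le> b\<close>])
        (rule has_vector_derivative_at_within[OF has_partialsD(1)[OF f that]])
    ultimately have "((\<lambda>y. f (b, y) - f (x, y)) has_vector_derivative
        integral (cbox x b) (\<lambda>s. f12 (s, y))) (at y within {0..1})"
      using y by (elim has_vector_derivative_transform[rotated 2]) auto
    moreover have "((\<lambda>y. f (b, y) - f (x, y)) has_vector_derivative f2 (b, y) - f2 (x, y)) (at y within {0..1})"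
      by (intro has_vector_derivative_diff has_partialsD(2)[OF f] y)
    ultimately show ?thesis
      using vector_derivative_unique_within_closed_interval[of 0 1 y] y by fastforce
  qed
  have "((\<lambda>b. integral {x..b} (\<lambda>s. f12 (s, y))) has_vector_derivative f12 (x, y)) (at x within {x..x+1})"
    by (rule integral_has_vector_derivative)
      (use y in \<open>auto intro!: continuous_on_strip_compose[OF has_partialsD(5)[OF f1]] continuous_intros\<close>)
  then have "((\<lambda>b. f2 (b, y) - f2 (x, y)) has_vector_derivative f12 (x, y)) (at x within {x..x+1})"
    by (rule has_vector_derivative_transform[rotated 2]) (auto simp: eq)
  moreover have "((\<lambda>b. f2 (b, y) - f2 (x, y)) has_vector_derivative f21 (x, y) - 0) (at x within {x..x+1})"
    by (intro has_vector_derivative_diff has_vector_derivative_at_within[OF has_partialsD(1)[OF f2 y]]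
        has_vector_derivative_const)
  ultimately show ?thesis
    using vector_derivative_unique_within_closed_interval[of x "x + 1" x] by fastforce
qed

section \<open>Integral inequalities\<close>

text \<open>
  Young's inequality is applied to the normalised functions. Adding \<open>\<tau> > 0\<close> to both norms avoids a separate
  treatment of vanishing norms; \<open>\<tau> \<rightarrow> 0\<close> gives the claim.
\<close>

lemma integral_Holder:
  fixes f g :: "'a::euclidean_space \<Rightarrow> real"
  assumes f: "continuous_on (cbox a b) f" "\<And>x. x \<in> cbox a b \<Longrightarrow> f x \<ge> 0"
    and g: "continuous_on (cbox a b) g" "\<And>x. x \<in> cbox a b \<Longrightarrow> g x \<ge> 0"
    and pq: "p > 1" "q > 1" "1 / p + 1 / q = 1"
  shows "integral (cbox a b) (\<lambda>x. f x * g x) \<le>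
    integral (cbox a b) (\<lambda>x. f x powr p) powr (1 / p) * integral (cbox a b) (\<lambda>x. g x powr q) powr (1 / q)"
proof -
  let ?I = "integral (cbox a b)"
  define A where "A = ?I (\<lambda>x. f x powr p)"
  define B where "B = ?I (\<lambda>x. g x powr q)"
  have cf: "continuous_on (cbox a b) (\<lambda>x. f x powr p)" and cg: "continuous_on (cbox a b) (\<lambda>x. g x powr q)"
    using f g pq by (auto intro!: continuous_on_powr' continuous_on_const)
  have A0: "A \<ge> 0" and B0: "B \<ge> 0"
    unfolding A_def B_def by (auto intro!: integral_nonneg integrable_continuous cf cg)
  have le: "?I (\<lambda>x. f x * g x) \<le> (A + \<tau>) powr (1 / p) * (B + \<tau>) powr (1 / q)" if \<tau>: "\<tau> > 0" for \<tau>
  proof -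
    define \<alpha> where "\<alpha> = (A + \<tau>) powr (1 / p)"
    define \<beta> where "\<beta> = (B + \<tau>) powr (1 / q)"
    have pos: "\<alpha> > 0" "\<beta> > 0" using A0 B0 \<tau> by (auto simp: \<alpha>_def \<beta>_def)
    have pw: "\<alpha> powr p = A + \<tau>" "\<beta> powr q = B + \<tau>"
      using A0 B0 \<tau> pq by (auto simp: \<alpha>_def \<beta>_def powr_powr)
    have pt: "f x * g x \<le> \<alpha> * \<beta> * (f x powr p / (p * (A + \<tau>)) + g x powr q / (q * (B + \<tau>)))"
      if x: "x \<in> cbox a b" for x
    proof -
      have "f x / \<alpha> * (g x / \<beta>) \<le> (f x / \<alpha>) powr p / p + (g x / \<beta>) powr q / q"
        using pos f(2)[OF x] g(2)[OF x] pq by (intro Youngs_inequality) auto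
      also have "\<dots> = f x powr p / (p * (A + \<tau>)) + g x powr q / (q * (B + \<tau>))"
        using pos f(2)[OF x] g(2)[OF x] by (simp add: powr_divide pw mult.commute)
      finally show ?thesis using pos by (simp add: field_simps)
    qed
    have "?I (\<lambda>x. f x * g x) \<le>
        ?I (\<lambda>x. \<alpha> * \<beta> * (f x powr p / (p * (A + \<tau>)) + g x powr q / (q * (B + \<tau>))))"
      by (intro integral_le integrable_continuous continuous_intros f(1) g(1) cf cg pt)
        (use pq A0 B0 \<tau> in auto)
    also have "\<dots> = \<alpha> * \<beta> * (A / (p * (A + \<tau>)) + B / (q * (B + \<tau>)))"
      unfolding A_def B_def integral_mult_right
      by (subst integral_add)
        (use pq A0 B0 \<tau> in \<open>auto simp: A_def B_def intro!: integrable_continuous continuous_intros cf cg\<close>)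
    also have "\<dots> \<le> \<alpha> * \<beta> * (1 / p + 1 / q)"
    proof (intro mult_left_mono add_mono)
      have "c / (k * (c + \<tau>)) \<le> 1 / k" if "c \<ge> 0" "k > 1" for c k :: real
      proof -
        have "c / (k * (c + \<tau>)) \<le> (c + \<tau>) / (k * (c + \<tau>))"
          using that \<tau> by (intro divide_right_mono) auto
        then show ?thesis using that \<tau> by simp
      qed
      then show "A / (p * (A + \<tau>)) \<le> 1 / p" "B / (q * (B + \<tau>)) \<le> 1 / q"
        using A0 B0 pq by blast+
    qed (use pos in auto)
    finally show ?thesis by (simp add: pq \<alpha>_def \<beta>_def)
  qed
  have "((\<lambda>\<tau>. (A + \<tau>) powr (1 / p) * (B + \<tau>) powr (1 / q)) \<longlongrightarrow>
      (A + 0) powr (1 / p) * (B + 0) powr (1 / q)) (at_right 0)"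
    by (intro tendsto_mult tendsto_powr2 tendsto_add tendsto_const tendsto_ident_at)
      (use A0 B0 pq in \<open>auto simp: eventually_at_right_less intro!: eventually_at_rightI[of 0 1]\<close>)
  then show ?thesis
    unfolding A_def[symmetric] B_def[symmetric]
    by (intro tendsto_lowerbound[of _ _ "at_right 0"])
      (auto intro!: eventually_at_rightI[of 0 1] le)
qed

lemma integral_Cauchy_Schwarz:
  fixes f g :: "'a::euclidean_space \<Rightarrow> real"
  assumes "continuous_on (cbox a b) f" "continuous_on (cbox a b) g"
  shows "integral (cbox a b) (\<lambda>x. \<bar>f x * g x\<bar>) \<le>
    sqrt (integral (cbox a b) (\<lambda>x. (f x)\<^sup>2)) * sqrt (integral (cbox a b) (\<lambda>x. (g x)\<^sup>2))"
proof -
  have nn: "integral (cbox a b) (\<lambda>x. (h x)\<^sup>2) \<ge> 0" if "continuous_on (cbox a b) h" for h :: "'a \<Rightarrow> real"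
    using that by (intro integral_nonneg integrable_continuous continuous_intros) auto
  show ?thesis
    using integral_Holder[of a b "\<lambda>x. \<bar>f x\<bar>" "\<lambda>x. \<bar>g x\<bar>" 2 2] assms nn[OF assms(1)] nn[OF assms(2)]
    by (simp add: abs_mult powr_half_sqrt continuous_on_rabs)
qed

lemma increment_square_le:
  fixes h h' :: "real \<Rightarrow> real"
  assumes h: "\<And>x. x \<in> {a..b} \<Longrightarrow> (h has_vector_derivative h' x) (at x within {a..b})"
    and c: "continuous_on {a..b} h'" and xy: "x \<in> {a..b}" "y \<in> {a..b}"
  shows "(h x - h y)\<^sup>2 \<le> (b - a) * integral {a..b} (\<lambda>s. (h' s)\<^sup>2)"
proof -
  have le: "(h v - h u)\<^sup>2 \<le> (b - a) * integral {a..b} (\<lambda>s. (h' s)\<^sup>2)"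
    if uv: "u \<le> v" "a \<le> u" "v \<le> b" for u v
  proof -
    have cu: "continuous_on {u..v} h'" using continuous_on_subset[OF c] uv by auto
    have sub: "integral {u..v} (\<lambda>s. (h' s)\<^sup>2) \<le> integral {a..b} (\<lambda>s. (h' s)\<^sup>2)"
      using uv by (intro integral_subset_le integrable_continuous_real continuous_intros c cu) auto
    have nn: "integral {u..v} (\<lambda>s. (h' s)\<^sup>2) \<ge> 0"
      by (intro integral_nonneg integrable_continuous_real continuous_intros cu) auto
    have "(h' has_integral (h v - h u)) {u..v}"
      by (rule fundamental_theorem_of_calculus[OF uv(1)], rule has_vector_derivative_within_subset[OF h])
        (use uv in auto)
    then have "\<bar>h v - h u\<bar> \<le> integral {u..v} (\<lambda>s. \<bar>1 * h' s\<bar>)"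
      using integral_norm_bound_integral[of h' "{u..v}" "\<lambda>s. \<bar>h' s\<bar>"] cu
      by (auto simp: integral_unique intro!: integrable_continuous_real continuous_intros)
    also have "\<dots> \<le> sqrt (v - u) * sqrt (integral {u..v} (\<lambda>s. (h' s)\<^sup>2))"
      using integral_Cauchy_Schwarz[of u v "\<lambda>_. 1" h'] cu uv by simp
    finally have "\<bar>h v - h u\<bar>\<^sup>2 \<le> (sqrt (v - u) * sqrt (integral {u..v} (\<lambda>s. (h' s)\<^sup>2)))\<^sup>2"
      by (intro power_mono) auto
    also have "\<dots> = (v - u) * integral {u..v} (\<lambda>s. (h' s)\<^sup>2)"
      using uv nn by (simp add: power_mult_distrib)
    also have "\<dots> \<le> (b - a) * integral {a..b} (\<lambda>s. (h' s)\<^sup>2)"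
      using uv sub nn by (intro mult_mono) auto
    finally show ?thesis by simp
  qed
  show ?thesis
  proof (cases "x \<le> y")
    case True
    then show ?thesis using le[of x y] xy by (simp add: power2_commute)
  next
    case False
    then show ?thesis using le[of y x] xy by simp
  qed
qed

text \<open>
  Any value \<open>g (x, y)\<close> is compared with \<open>c = g (x', 0)\<close> along a horizontal and a vertical segment, which bounds
  \<open>\<integral>(g - c)\<^sup>2\<close>. For mean-free \<open>g\<close> this integral is at least \<open>\<integral>g\<^sup>2\<close>, whatever \<open>c\<close> is, so it suffices to average the
  bound over \<open>x'\<close>.
\<close>

lemma Poincare_mean_zero:
  fixes g :: "real \<times> real \<Rightarrow> real"
  assumes \<Gamma>: "\<Gamma> > 0" and g: "has_partials g g1 g2" and mean: "integral (rect 0 \<Gamma>) g = 0"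
  shows "integral (rect 0 \<Gamma>) (\<lambda>z. (g z)\<^sup>2) \<le>
    2 * \<Gamma>\<^sup>2 * integral (rect 0 \<Gamma>) (\<lambda>z. (g1 z)\<^sup>2) + 2 * integral (rect 0 \<Gamma>) (\<lambda>z. (g2 z)\<^sup>2)"
proof -
  let ?I = "integral (rect 0 \<Gamma>)"
  note cg = has_partialsD(3-5)[OF g]
  have cg1: "continuous_on strip (\<lambda>z. (g1 z)\<^sup>2)" and cg2: "continuous_on strip (\<lambda>z. (g2 z)\<^sup>2)"
    and cgq: "continuous_on strip (\<lambda>z. (g z)\<^sup>2)"
    using cg by (auto intro!: continuous_intros)
  define A where "A y = integral {0..\<Gamma>} (\<lambda>x. (g1 (x, y))\<^sup>2)" for y
  define B where "B x = integral {0..1} (\<lambda>y. (g2 (x, y))\<^sup>2)" for x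
  have cA: "continuous_on {0..1} A" unfolding A_def by (rule continuous_on_integral_x[OF cg1])
  have cB: "continuous_on UNIV B" unfolding B_def by (rule continuous_on_integral_y[OF cg2])
  have cAs: "continuous_on strip (\<lambda>z. A (snd z))"
    by (rule continuous_on_compose2[OF cA]) (auto intro!: continuous_intros simp: strip_def)
  have IA: "?I (\<lambda>z. A (snd z)) = \<Gamma> * ?I (\<lambda>z. (g1 z)\<^sup>2)"
    unfolding integral_rect_iterated(2)[OF cAs] integral_rect_iterated(2)[OF cg1]
    using \<Gamma> by (simp add: A_def)
  have IB: "integral {0..\<Gamma>} B = ?I (\<lambda>z. (g2 z)\<^sup>2)"
    unfolding integral_rect_iterated(1)[OF cg2] B_def ..
  have content: "Henstock_Kurzweil_Integration.content (rect 0 \<Gamma>) = \<Gamma>"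
    using \<Gamma> by (simp add: content_Pair)
  have le: "?I (\<lambda>z. (g z)\<^sup>2) \<le> 2 * \<Gamma>\<^sup>2 * ?I (\<lambda>z. (g1 z)\<^sup>2) + 2 * \<Gamma> * B x'"
    if x': "x' \<in> {0..\<Gamma>}" for x'
  proof -
    define c where "c = g (x', 0)"
    have pt: "(g z - c)\<^sup>2 \<le> 2 * \<Gamma> * A (snd z) + 2 * B x'" if "z \<in> rect 0 \<Gamma>" for z
    proof -
      obtain x y where z: "z = (x, y)" and xy: "x \<in> {0..\<Gamma>}" "y \<in> {0..1}"
        using \<open>z \<in> rect 0 \<Gamma>\<close> by (cases z) (auto simp: cbox_Pair_eq)
      have "(g (x, y) - g (x', y))\<^sup>2 \<le> (\<Gamma> - 0) * A y"
        unfolding A_def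
        by (rule increment_square_le[where h = "\<lambda>x. g (x, y)"])
          (use xy x' in \<open>auto intro!: has_vector_derivative_at_within[OF has_partialsD(1)[OF g]]
            continuous_on_strip_compose[OF cg(2)] continuous_intros\<close>)
      moreover have "(g (x', y) - g (x', 0))\<^sup>2 \<le> (1 - 0) * B x'"
        unfolding B_def
        by (rule increment_square_le[where h = "\<lambda>y. g (x', y)"])
          (use xy x' in \<open>auto intro!: has_partialsD(2)[OF g]
            continuous_on_strip_compose[OF cg(3)] continuous_intros\<close>)
      moreover have "(u + v)\<^sup>2 \<le> 2 * u\<^sup>2 + 2 * v\<^sup>2" for u v :: real
        using sum_squares_bound[of u v] by (simp add: power2_sum)
      from this[of "g (x, y) - g (x', y)" "g (x', y) - g (x', 0)"]
      have "(g (x, y) - g (x', 0))\<^sup>2 \<le> 2 * (g (x, y) - g (x', y))\<^sup>2 + 2 * (g (x', y) - g (x', 0))\<^sup>2"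
        by simp
      ultimately show ?thesis unfolding z c_def by simp
    qed
    have "?I (\<lambda>z. (g z)\<^sup>2) \<le> ?I (\<lambda>z. (g z)\<^sup>2) - 2 * c * ?I g + \<Gamma> * c\<^sup>2"
      using \<Gamma> by (simp add: mean)
    also have "\<dots> = ?I (\<lambda>z. (g z)\<^sup>2 - 2 * c * g z + c\<^sup>2)"
      by (subst integral_add integral_diff;
          (intro integrable_on_rect continuous_intros cg)?)+ (simp add: content)
    also have "\<dots> = ?I (\<lambda>z. (g z - c)\<^sup>2)"
      by (intro integral_cong) (simp add: power2_eq_square algebra_simps)
    also have "\<dots> \<le> ?I (\<lambda>z. 2 * \<Gamma> * A (snd z) + 2 * B x')"
      by (intro integral_le integrable_on_rect continuous_intros cg cAs pt)
    also have "\<dots> = 2 * \<Gamma>\<^sup>2 * ?I (\<lambda>z. (g1 z)\<^sup>2) + 2 * \<Gamma> * B x'"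
      by (subst integral_add;
          (intro integrable_on_rect continuous_intros cAs)?)
        (simp add: content IA power2_eq_square)
    finally show ?thesis .
  qed
  have "integral {0..\<Gamma>} (\<lambda>_. ?I (\<lambda>z. (g z)\<^sup>2)) \<le>
      integral {0..\<Gamma>} (\<lambda>x'. 2 * \<Gamma>\<^sup>2 * ?I (\<lambda>z. (g1 z)\<^sup>2) + 2 * \<Gamma> * B x')"
    by (intro integral_le integrable_continuous_real continuous_intros continuous_on_subset[OF cB] le) auto
  also have "\<dots> = \<Gamma> * (2 * \<Gamma>\<^sup>2 * ?I (\<lambda>z. (g1 z)\<^sup>2) + 2 * ?I (\<lambda>z. (g2 z)\<^sup>2))"
    by (subst integral_add;
        (intro integrable_continuous_real continuous_intros continuous_on_subset[OF cB])?)
      (use \<Gamma> in \<open>auto simp: IB algebra_simps\<close>)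
  finally show ?thesis using \<Gamma> by simp
qed

section \<open>The regularised Cauchy kernel\<close>

definition sqdist :: "real \<times> real \<Rightarrow> real \<times> real \<Rightarrow> real"
  where "sqdist z w = (fst z - fst w)\<^sup>2 + (snd z - snd w)\<^sup>2"

text \<open>
  This is the complex conjugate of \<open>z - w\<close> divided by \<open>\<bar>z - w\<bar>\<^sup>2 + e\<close>, a smooth substitute for \<open>1 / (z - w)\<close>: all
  integrands below stay continuous and no disc has to be cut out around \<open>w\<close>.
\<close>

definition cauchy_kernel :: "real \<Rightarrow> real \<times> real \<Rightarrow> real \<times> real \<Rightarrow> complex"
  where "cauchy_kernel e w z =
    (1 / (sqdist z w + e)) *\<^sub>R (of_real (fst z - fst w) - \<i> * of_real (snd z - snd w))"

text \<open>
  The image of \<open>cauchy_kernel e w\<close> under \<open>\<partial>\<^sub>1 + \<i> \<partial>\<^sub>2\<close>. As \<open>e \<rightarrow> 0\<close> it concentrates at \<open>w\<close>.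
\<close>

definition delta_kernel :: "real \<Rightarrow> real \<times> real \<Rightarrow> real \<times> real \<Rightarrow> real"
  where "delta_kernel e w z = 2 * e / (sqdist z w + e)\<^sup>2"

definition mirror :: "real \<Rightarrow> real \<times> real \<Rightarrow> real \<times> real"
  where "mirror b w = (fst w, 2 * b - snd w)"

lemma sqdist_nonneg [simp]: "0 \<le> sqdist z w"
  by (simp add: sqdist_def)

lemma sqdist_pos [simp]: "e > 0 \<Longrightarrow> sqdist z w + e > 0" "e > 0 \<Longrightarrow> sqdist z w + e \<noteq> 0"
  using sqdist_nonneg[of z w] by linarith+

lemma continuous_on_sqdist [continuous_intros]: "continuous_on A (\<lambda>z. sqdist z w)"
  unfolding sqdist_def by (intro continuous_intros)

lemma continuous_on_delta_kernel:
  "e > 0 \<Longrightarrow> continuous_on A (delta_kernel e w)"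
  unfolding delta_kernel_def by (intro continuous_intros) auto

lemma delta_kernel_nonneg: "e > 0 \<Longrightarrow> 0 \<le> delta_kernel e w z"
  by (simp add: delta_kernel_def)

lemma cauchy_kernel_partials:
  assumes e: "e > 0"
  obtains k1 k2 where "has_partials (cauchy_kernel e w) k1 k2"
    and "\<And>z. k1 z + \<i> * k2 z = of_real (delta_kernel e w z)"
proof
  define c where "c z = complex_of_real (fst z - fst w) - \<i> * of_real (snd z - snd w)" for z
  define N where "N z = sqdist z w + e" for z
  have N: "N z > 0" "N z \<noteq> 0" for z using e by (auto simp: N_def)
  define k1 where "k1 z = (1 / N z) *\<^sub>R 1 + (- (2 * (fst z - fst w)) / (N z)\<^sup>2) *\<^sub>R c z" for z
  define k2 where "k2 z = (1 / N z) *\<^sub>R (- \<i>) + (- (2 * (snd z - snd w)) / (N z)\<^sup>2) *\<^sub>R c z" for z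
  have ck: "cauchy_kernel e w = (\<lambda>z. (1 / N z) *\<^sub>R c z)"
    by (simp add: fun_eq_iff cauchy_kernel_def N_def c_def)
  have cN: "continuous_on A N" and cc: "continuous_on A c" for A
    unfolding N_def c_def by (auto intro!: continuous_intros)
  show "has_partials (cauchy_kernel e w) k1 k2"
    unfolding ck
  proof (rule has_partialsI)
    fix x y :: real
    have "((\<lambda>s. 1 / N (s, y)) has_real_derivative - (2 * (x - fst w)) / (N (x, y))\<^sup>2) (at x)"
      using N(2)[of "(x, y)"] unfolding N_def sqdist_def
      by (auto intro!: derivative_eq_intros simp: power2_eq_square)
    moreover have "((\<lambda>s. c (s, y)) has_vector_derivative 1) (at x)"
      unfolding c_def by (auto intro!: derivative_eq_intros)
    ultimately show "((\<lambda>s. (1 / N (s, y)) *\<^sub>R c (s, y)) has_vector_derivative k1 (x, y)) (at x)"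
      unfolding k1_def fst_conv snd_conv by (rule has_vector_derivative_scaleR)
    have "((\<lambda>s. 1 / N (x, s)) has_real_derivative - (2 * (y - snd w)) / (N (x, y))\<^sup>2) (at y within {0..1})"
      using N(2)[of "(x, y)"] unfolding N_def sqdist_def
      by (auto intro!: derivative_eq_intros simp: power2_eq_square)
    moreover have "((\<lambda>s. c (x, s)) has_vector_derivative - \<i>) (at y within {0..1})"
      unfolding c_def by (auto intro!: derivative_eq_intros)
    ultimately show "((\<lambda>s. (1 / N (x, s)) *\<^sub>R c (x, s)) has_vector_derivative k2 (x, y)) (at y within {0..1})"
      unfolding k2_def fst_conv snd_conv by (rule has_vector_derivative_scaleR)
  qed (auto simp: k1_def k2_def N(2) intro!: continuous_intros cN cc)
  fix z :: "real \<times> real"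
  define X where "X = fst z - fst w"
  define Y where "Y = snd z - snd w"
  have Nz: "N z = X\<^sup>2 + Y\<^sup>2 + e" by (simp add: N_def sqdist_def X_def Y_def)
  have "k1 z + \<i> * k2 z = of_real (1 / N z - 2 * X\<^sup>2 / (N z)\<^sup>2 + (1 / N z - 2 * Y\<^sup>2 / (N z)\<^sup>2))"
    unfolding k1_def k2_def c_def X_def[symmetric] Y_def[symmetric]
    by (simp add: complex_eq_iff power2_eq_square)
  also have "1 / N z - 2 * X\<^sup>2 / (N z)\<^sup>2 + (1 / N z - 2 * Y\<^sup>2 / (N z)\<^sup>2) = delta_kernel e w z"
  proof -
    have "1 / N z = N z / (N z)\<^sup>2" using N(2)[of z] by (simp add: power2_eq_square)
    then have "1 / N z - 2 * X\<^sup>2 / (N z)\<^sup>2 + (1 / N z - 2 * Y\<^sup>2 / (N z)\<^sup>2) =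
        (2 * N z - 2 * X\<^sup>2 - 2 * Y\<^sup>2) / (N z)\<^sup>2"
      by (simp add: diff_divide_distrib)
    also have "\<dots> = delta_kernel e w z"
      unfolding delta_kernel_def N_def[symmetric] by (simp add: Nz)
    finally show ?thesis .
  qed
  finally show "k1 z + \<i> * k2 z = of_real (delta_kernel e w z)" .
qed

lemma norm_cauchy_kernel_le:
  assumes e: "e > 0"
  shows "norm (cauchy_kernel e w z) \<le> 1 / sqrt (sqdist z w + e)"
proof -
  let ?N = "sqdist z w + e"
  have "norm (of_real (fst z - fst w) - \<i> * of_real (snd z - snd w)) = sqrt (sqdist z w)"
    by (simp add: cmod_def sqdist_def power2_commute[of "snd w" "snd z"])
  then have "norm (cauchy_kernel e w z) = sqrt (sqdist z w) / ?N"
    using e by (simp add: cauchy_kernel_def)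
  also have "\<dots> \<le> sqrt ?N / ?N"
    using e by (intro divide_right_mono) (auto intro: add_nonneg_nonneg)
  also have "\<dots> = 1 / sqrt ?N"
    using sqdist_pos(1)[OF e, of z w] by (simp add: sqrt_divide_self_eq inverse_eq_divide less_imp_le)
  finally show ?thesis .
qed

lemma cauchy_kernel_mirror:
  "cauchy_kernel e (mirror b w) (x, b) = cnj (cauchy_kernel e w (x, b))"
proof -
  have "sqdist (x, b) (mirror b w) = sqdist (x, b) w"
    by (simp add: sqdist_def mirror_def power2_commute)
  then show ?thesis
    by (simp add: cauchy_kernel_def mirror_def complex_eq_iff)
qed

text \<open>
  The first inequality transfers every estimate of the kernel at \<open>w\<close> to the kernel at the image point. The
  second one keeps the image point away from the strip.
\<close>

lemma sqdist_mirror_ge: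
  assumes "b \<in> {0, 1}" "z \<in> strip" "w \<in> strip"
  shows "sqdist z w \<le> sqdist z (mirror b w)" "(snd w - b)\<^sup>2 \<le> sqdist z (mirror b w)"
proof -
  obtain x y where z: "z = (x, y)" "0 \<le> y" "y \<le> 1" using assms(2) by (cases z) auto
  obtain p q where w: "w = (p, q)" "0 \<le> q" "q \<le> 1" using assms(3) by (cases w) auto
  have "(y - (2 * b - q))\<^sup>2 - (y - q)\<^sup>2 = 4 * ((q - b) * (y - b))"
    by (simp add: power2_eq_square algebra_simps)
  moreover have "0 \<le> (q - b) * (y - b)"
    using assms(1) z w by (auto intro: mult_nonneg_nonneg mult_nonpos_nonpos)
  ultimately show "sqdist z w \<le> sqdist z (mirror b w)"
    by (simp add: sqdist_def mirror_def z w)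
  have "\<bar>q - b\<bar> \<le> \<bar>y - (2 * b - q)\<bar>"
    using assms(1) z w by auto
  then have "(q - b)\<^sup>2 \<le> (y - (2 * b - q))\<^sup>2"
    by (rule abs_le_square_iff[THEN iffD1])
  also have "\<dots> \<le> sqdist z (mirror b w)"
    by (simp add: sqdist_def mirror_def z w)
  finally show "(snd w - b)\<^sup>2 \<le> sqdist z (mirror b w)" by (simp add: w)
qed

lemma integral_dbar:
  fixes h :: "real \<times> real \<Rightarrow> complex"
  assumes "has_partials h h1 h2" "a \<le> b"
  shows "integral (rect a b) (\<lambda>z. h1 z + \<i> * h2 z) =
    integral {0..1} (\<lambda>y. h (b, y) - h (a, y)) + \<i> * integral {a..b} (\<lambda>x. h (x, 1) - h (x, 0))"
  using integral_partial_x[OF assms] integral_partial_y[OF assms(1), of a b]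
    has_partialsD(3-5)[OF assms(1)]
  by (subst integral_add)
    (auto intro!: integrable_on_rect continuous_intros simp: integral_mult_right)

text \<open>
  The divergence theorem is applied to \<open>\<phi>\<close> times the kernel, once with pole \<open>w\<close> and once with pole at the mirror
  image of \<open>w\<close> in the wall \<open>x\<^sub>2 = b\<close>. Only the boundary integral over this wall survives. There \<open>\<phi>\<close> is real and the
  two kernels are conjugate to each other, so adding the conjugate of the second identity cancels it. This is
  the Schwarz reflection of \<open>\<phi>\<close> carried out without extending \<open>\<phi>\<close> across the wall.
\<close>

lemma reflected_Cauchy_Pompeiu:
  fixes \<phi> :: "real \<times> real \<Rightarrow> complex"
  assumes \<phi>: "has_partials \<phi> \<phi>1 \<phi>2" and ab: "a \<le> c" and e: "e > 0" and b: "b \<in> {0, 1}"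
    and side: "\<And>y. y \<in> {0..1} \<Longrightarrow> \<phi> (a, y) = 0 \<and> \<phi> (c, y) = 0"
    and far: "\<And>x. \<phi> (x, 1 - b) = 0" and near: "\<And>x. Im (\<phi> (x, b)) = 0"
    and w: "w \<in> strip"
  shows "norm (integral (rect a c) (\<lambda>z. \<phi> z * of_real (delta_kernel e w z)
      + cnj (\<phi> z) * of_real (delta_kernel e (mirror b w) z)))
    \<le> 2 * integral (rect a c) (\<lambda>z. norm (\<phi>1 z + \<i> * \<phi>2 z) * (1 / sqrt (sqdist z w + e)))"
proof -
  let ?I = "integral (rect a c)"
  let ?k = "cauchy_kernel e"
  let ?w = "mirror b w"
  let ?D = "\<lambda>z. \<phi>1 z + \<i> * \<phi>2 z"
  let ?\<kappa> = "\<lambda>z. norm (?D z) * (1 / sqrt (sqdist z w + e))"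
  note c\<phi> = has_partialsD(3-5)[OF \<phi>]
  have ck: "continuous_on strip (?k v)" for v
    using cauchy_kernel_partials[OF e, of v] has_partialsD(3) by metis
  define \<sigma> :: complex where "\<sigma> = (if b = 1 then \<i> else - \<i>)"
  define J where "J = integral {a..c} (\<lambda>x. \<phi> (x, b) * ?k w (x, b))"
  have G: "?I (\<lambda>z. ?D z * ?k v z) + ?I (\<lambda>z. \<phi> z * of_real (delta_kernel e v z)) =
      \<sigma> * integral {a..c} (\<lambda>x. \<phi> (x, b) * ?k v (x, b))" for v
  proof -
    obtain k1 k2 where k: "has_partials (?k v) k1 k2"
        "\<And>z. k1 z + \<i> * k2 z = of_real (delta_kernel e v z)"
      using cauchy_kernel_partials[OF e] by metis
    have "?I (\<lambda>z. (\<phi> z * k1 z + \<phi>1 z * ?k v z) + \<i> * (\<phi> z * k2 z + \<phi>2 z * ?k v z)) =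
        integral {0..1} (\<lambda>y. \<phi> (c, y) * ?k v (c, y) - \<phi> (a, y) * ?k v (a, y)) +
        \<i> * integral {a..c} (\<lambda>x. \<phi> (x, 1) * ?k v (x, 1) - \<phi> (x, 0) * ?k v (x, 0))"
      by (rule integral_dbar[OF has_partials_mult[OF \<phi> k(1)] ab])
    also have "integral {0..1} (\<lambda>y. \<phi> (c, y) * ?k v (c, y) - \<phi> (a, y) * ?k v (a, y)) = 0"
      using side by (intro integral_unique has_integral_is_0) auto
    also have "\<i> * integral {a..c} (\<lambda>x. \<phi> (x, 1) * ?k v (x, 1) - \<phi> (x, 0) * ?k v (x, 0)) =
        \<sigma> * integral {a..c} (\<lambda>x. \<phi> (x, b) * ?k v (x, b))"
      using b far by (auto simp: \<sigma>_def)
    also have "?I (\<lambda>z. (\<phi> z * k1 z + \<phi>1 z * ?k v z) + \<i> * (\<phi> z * k2 z + \<phi>2 z * ?k v z)) =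
        ?I (\<lambda>z. ?D z * ?k v z + \<phi> z * of_real (delta_kernel e v z))"
      by (intro integral_cong) (simp add: k(2)[symmetric] algebra_simps)
    also have "\<dots> = ?I (\<lambda>z. ?D z * ?k v z) + ?I (\<lambda>z. \<phi> z * of_real (delta_kernel e v z))"
      by (intro integral_add integrable_on_rect continuous_intros c\<phi> ck continuous_on_delta_kernel[OF e])
    finally show ?thesis by simp
  qed
  have J': "integral {a..c} (\<lambda>x. \<phi> (x, b) * ?k ?w (x, b)) = cnj J"
  proof -
    have "cnj (\<phi> (x, b)) = \<phi> (x, b)" for x
      using near by (simp add: complex_eq_iff)
    then show ?thesis
      unfolding J_def cauchy_kernel_mirror by (simp add: Henstock_Kurzweil_Integration.integral_cnj)
  qed
  let ?A = "?I (\<lambda>z. ?D z * ?k w z)" and ?B = "?I (\<lambda>z. ?D z * ?k ?w z)"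
  have "?A + ?I (\<lambda>z. \<phi> z * of_real (delta_kernel e w z)) + cnj (?B + ?I (\<lambda>z. \<phi> z * of_real (delta_kernel e ?w z))) = 0"
    unfolding G J' J_def[symmetric] by (simp add: \<sigma>_def)
  then have "?I (\<lambda>z. \<phi> z * of_real (delta_kernel e w z)) + cnj (?I (\<lambda>z. \<phi> z * of_real (delta_kernel e ?w z)))
      = - ?A - cnj ?B"
    by (simp add: algebra_simps eq_neg_iff_add_eq_0)
  also have "cnj (?I (\<lambda>z. \<phi> z * of_real (delta_kernel e ?w z))) =
      ?I (\<lambda>z. cnj (\<phi> z) * of_real (delta_kernel e ?w z))"
    by (simp add: Henstock_Kurzweil_Integration.integral_cnj)
  also have "?I (\<lambda>z. \<phi> z * of_real (delta_kernel e w z)) + \<dots> = ?I (\<lambda>z. \<phi> z * of_real (delta_kernel e w z)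
      + cnj (\<phi> z) * of_real (delta_kernel e ?w z))"
    by (intro integral_add[symmetric] integrable_on_rect continuous_intros c\<phi> continuous_on_delta_kernel[OF e])
  finally have eq: "?I (\<lambda>z. \<phi> z * of_real (delta_kernel e w z)
      + cnj (\<phi> z) * of_real (delta_kernel e ?w z)) = - ?A - cnj ?B" .
  have bd: "norm (?I (\<lambda>z. ?D z * ?k v z)) \<le> ?I ?\<kappa>"
    if v: "\<And>z. z \<in> strip \<Longrightarrow> sqdist z w \<le> sqdist z v" for v
  proof (rule integral_norm_bound_integral)
    show "(\<lambda>z. ?D z * ?k v z) integrable_on rect a c"
      by (intro integrable_on_rect continuous_intros c\<phi> ck)
    show "?\<kappa> integrable_on rect a c"
      using e by (intro integrable_on_rect continuous_intros c\<phi>) (auto simp: less_imp_neq)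
    fix z assume "z \<in> rect a c"
    then have z: "z \<in> strip" using rect_subset_strip by blast
    have "norm (?k v z) \<le> 1 / sqrt (sqdist z v + e)" by (rule norm_cauchy_kernel_le[OF e])
    also have "\<dots> \<le> 1 / sqrt (sqdist z w + e)"
      using v[OF z] e by (intro divide_left_mono) auto
    finally show "norm (?D z * ?k v z) \<le> ?\<kappa> z"
      unfolding norm_mult by (rule mult_left_mono) simp
  qed
  have "norm (- ?A - cnj ?B) \<le> norm ?A + norm ?B"
    using norm_triangle_ineq4[of "- ?A" "cnj ?B"] by simp
  also have "\<dots> \<le> ?I ?\<kappa> + ?I ?\<kappa>"
    by (intro add_mono bd sqdist_mirror_ge(1) b w) auto
  finally show ?thesis unfolding eq by simp
qed

text \<open>
  The point value is recovered by comparing \<open>\<phi>\<close> with the constant \<open>\<phi> (p, q)\<close> under \<open>delta_kernel\<close>. A lower bound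
  for the mass \<open>m\<close> of the kernel is enough, since the error terms are either proportional to \<open>m\<close> or \<open>O(e)\<close>. The
  point is interior, so the kernel at the image point contributes only to the \<open>O(e)\<close> part.
\<close>

lemma delta_kernel_concentrates:
  fixes \<phi> :: "real \<times> real \<Rightarrow> complex"
  assumes c\<phi>: "continuous_on strip \<phi>" and L: "L > 0" and b: "b \<in> {0, 1}" and q: "0 < q" "q < 1"
    and bd: "\<And>e. e > 0 \<Longrightarrow> norm (integral (rect (p - L) (p + L))
      (\<lambda>z. \<phi> z * of_real (delta_kernel e (p, q) z)
         + cnj (\<phi> z) * of_real (delta_kernel e (mirror b (p, q)) z))) \<le> B"
  shows "norm (\<phi> (p, q)) \<le> 9 / 8 * B"
proof -
  let ?R = "rect (p - L) (p + L)"
  let ?I = "integral ?R"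
  define w where "w = (p, q)"
  have ws: "w \<in> strip" and wR: "w \<in> ?R" using q L by (auto simp: w_def cbox_Pair_eq)
  have "bounded (\<phi> ` ?R)"
    by (intro compact_imp_bounded compact_continuous_image compact_cbox
        continuous_on_subset[OF c\<phi> rect_subset_strip])
  then obtain M where M: "\<And>z. z \<in> ?R \<Longrightarrow> norm (\<phi> z) \<le> M" by (auto simp: bounded_iff)
  have M0: "M \<ge> 0" using M[OF wR] norm_ge_zero[of "\<phi> w"] by linarith
  have B0: "B \<ge> 0" using order_trans[OF norm_ge_zero bd[of 1]] by simp
  define d where "d = \<bar>q - b\<bar>"
  have d: "d > 0" using b q by (auto simp: d_def)
  have "norm (\<phi> w) \<le> 9 / 8 * B + \<tau>" if \<tau>': "\<tau> > 0" for \<tau>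
  proof -
    define t where "t = \<tau> / 2"
    have t: "t > 0" using \<tau>' by (simp add: t_def)
    obtain \<delta> where \<delta>: "\<delta> > 0" "\<And>z. z \<in> strip \<Longrightarrow> dist z w < \<delta> \<Longrightarrow> dist (\<phi> z) (\<phi> w) < t"
      using c\<phi> ws t unfolding continuous_on_iff by metis
    \<comment> \<open>\<open>e * K\<close> bounds what the two kernels contribute away from \<open>w\<close>.\<close>
    define K where "K = 2 * M * (2 / \<delta> ^ 4) + M * (2 / d ^ 4)"
    define Q where "Q = 2 * L * K"
    have K0: "K \<ge> 0" using M0 \<delta>(1) d by (simp add: K_def)
    have Q0: "Q \<ge> 0" using K0 L by (simp add: Q_def)
    define \<epsilon> where "\<epsilon> = Min {1, L, q, 1 - q, t / (2 * (Q + 1))}"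
    have \<epsilon>: "\<epsilon> > 0" "\<epsilon> \<le> 1" "\<epsilon> \<le> L" "\<epsilon> \<le> q" "\<epsilon> \<le> 1 - q" "\<epsilon> \<le> t / (2 * (Q + 1))"
      using L q t Q0 by (auto simp: \<epsilon>_def)
    define e where "e = \<epsilon>\<^sup>2"
    have e: "e > 0" using \<epsilon>(1) by (simp add: e_def)
    have eQ: "9 / 8 * (e * Q) \<le> t"
    proof -
      have "e \<le> \<epsilon>" using \<epsilon>(1,2) by (simp add: e_def power2_eq_square mult_left_le)
      then have "e * Q \<le> t / (2 * (Q + 1)) * (Q + 1)"
        using \<epsilon>(6) Q0 t by (intro mult_mono) auto
      also have "\<dots> = t / 2"
      proof -
        have "t / (2 * x) * x = t / 2" if "x > 0" for x :: real using that by simp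
        then show ?thesis using Q0 by (meson add_nonneg_pos zero_less_one)
      qed
      finally show ?thesis using t by simp
    qed
    note i = integrable_on_rect and cd = continuous_on_delta_kernel[OF e]
    define m where "m = ?I (delta_kernel e w)"
    \<comment> \<open>On the square of half-side \<open>\<epsilon>\<close> around \<open>w\<close>, of area \<open>4 e\<close>, the kernel is at least \<open>2 e / (3 e)\<^sup>2\<close>.\<close>
    have m: "m \<ge> 8 / 9"
    proof -
      let ?S = "cbox (p - \<epsilon>, q - \<epsilon>) (p + \<epsilon>, q + \<epsilon>)"
      have "8 / 9 = integral ?S (\<lambda>_. 2 * e / (3 * e)\<^sup>2)"
        using \<epsilon>(1) by (simp add: content_Pair e_def power2_eq_square field_simps)
      also have "\<dots> \<le> integral ?S (delta_kernel e w)"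
      proof (rule integral_le)
        fix z assume "z \<in> ?S"
        then have "\<bar>fst z - p\<bar> \<le> \<epsilon>" "\<bar>snd z - q\<bar> \<le> \<epsilon>"
          by (cases z; auto simp: cbox_Pair_eq)+
        then have "(fst z - p)\<^sup>2 \<le> \<epsilon>\<^sup>2" "(snd z - q)\<^sup>2 \<le> \<epsilon>\<^sup>2"
          using \<epsilon>(1) by (auto simp flip: abs_le_square_iff)
        then have "sqdist z w + e \<le> 3 * e" by (simp add: sqdist_def w_def e_def)
        then have "(sqdist z w + e)\<^sup>2 \<le> (3 * e)\<^sup>2"
          using e by (intro power_mono add_nonneg_nonneg) auto
        then show "2 * e / (3 * e)\<^sup>2 \<le> delta_kernel e w z"
          unfolding delta_kernel_def using e by (intro divide_left_mono) auto
      qed (auto intro!: integrable_continuous cd)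
      also have "\<dots> \<le> m"
        unfolding m_def
      proof (rule integral_subset_le)
        show "?S \<subseteq> ?R" using \<epsilon> by (auto simp: cbox_Pair_eq)
      qed (intro ballI integrable_continuous cd delta_kernel_nonneg e)+
      finally show ?thesis .
    qed
    let ?w = "mirror b w"
    let ?g = "\<lambda>z. \<phi> z * of_real (delta_kernel e w z) + cnj (\<phi> z) * of_real (delta_kernel e ?w z)"
    have far: "delta_kernel e v z \<le> e * (2 / \<rho> ^ 4)" if "\<rho>\<^sup>2 \<le> sqdist z v" "\<rho> > 0" for v z \<rho>
    proof -
      have "(\<rho>\<^sup>2)\<^sup>2 \<le> (sqdist z v + e)\<^sup>2"
        using that e by (intro power_mono) auto
      then have "\<rho> ^ 4 \<le> (sqdist z v + e)\<^sup>2" by (simp flip: power_mult)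
      then have "2 * e / (sqdist z v + e)\<^sup>2 \<le> 2 * e / \<rho> ^ 4"
        using e that by (intro divide_left_mono) auto
      then show ?thesis by (simp add: delta_kernel_def mult.commute)
    qed
    have pt: "norm (?g z - \<phi> w * of_real (delta_kernel e w z)) \<le> t * delta_kernel e w z + e * K"
      if z: "z \<in> ?R" for z
    proof -
      have zs: "z \<in> strip" using z rect_subset_strip by blast
      have dn: "delta_kernel e v z \<ge> 0" for v using delta_kernel_nonneg[OF e] .
      have 1: "norm (\<phi> z - \<phi> w) * delta_kernel e w z \<le> t * delta_kernel e w z + e * (2 * M * (2 / \<delta> ^ 4))"
      proof (cases "dist z w < \<delta>")
        case True
        then have "norm (\<phi> z - \<phi> w) \<le> t" using \<delta>(2)[OF zs] by (simp add: dist_norm)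
        then have "norm (\<phi> z - \<phi> w) * delta_kernel e w z \<le> t * delta_kernel e w z"
          using dn by (rule mult_right_mono)
        moreover have "0 \<le> e * (2 * M * (2 / \<delta> ^ 4))" using e M0 \<delta>(1) by simp
        ultimately show ?thesis by linarith
      next
        case False
        have "dist z w = sqrt (sqdist z w)"
          by (simp add: dist_prod_def sqdist_def dist_real_def)
        then have "\<delta> \<le> sqrt (sqdist z w)" using False by simp
        then have "\<delta>\<^sup>2 \<le> sqdist z w"
          using \<delta>(1) by (metis less_eq_real_def power_mono real_sqrt_pow2 sqdist_nonneg)
        then have "delta_kernel e w z \<le> e * (2 / \<delta> ^ 4)" using far \<delta>(1) by blast
        moreover have "norm (\<phi> z - \<phi> w) \<le> 2 * M"
          using norm_triangle_ineq4[of "\<phi> z" "\<phi> w"] M[OF z] M[OF wR] by linarith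
        ultimately have "norm (\<phi> z - \<phi> w) * delta_kernel e w z \<le> 2 * M * (e * (2 / \<delta> ^ 4))"
          using dn M0 by (intro mult_mono) auto
        moreover have "0 \<le> t * delta_kernel e w z" using t dn by simp
        ultimately show ?thesis by (simp add: algebra_simps)
      qed
      have "d\<^sup>2 \<le> sqdist z ?w"
        using sqdist_mirror_ge(2)[OF b zs ws] by (simp add: d_def w_def)
      then have "delta_kernel e ?w z \<le> e * (2 / d ^ 4)" using far d by blast
      then have 2: "norm (\<phi> z) * delta_kernel e ?w z \<le> M * (e * (2 / d ^ 4))"
        using dn M[OF z] M0 by (intro mult_mono) auto
      have eq: "?g z - \<phi> w * of_real (delta_kernel e w z) =
          (\<phi> z - \<phi> w) * of_real (delta_kernel e w z) + cnj (\<phi> z) * of_real (delta_kernel e ?w z)"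
        by (simp add: algebra_simps)
      have "norm (?g z - \<phi> w * of_real (delta_kernel e w z)) \<le>
          norm (\<phi> z - \<phi> w) * delta_kernel e w z + norm (\<phi> z) * delta_kernel e ?w z"
        unfolding eq using norm_triangle_ineq[of "(\<phi> z - \<phi> w) * of_real (delta_kernel e w z)"
            "cnj (\<phi> z) * of_real (delta_kernel e ?w z)"] dn
        by (simp add: norm_mult)
      also have "\<dots> \<le> t * delta_kernel e w z + e * K"
        using 1 2 by (simp add: K_def algebra_simps)
      finally show ?thesis .
    qed
    have content: "Henstock_Kurzweil_Integration.content ?R = 2 * L"
      using L by (simp add: content_Pair)
    have "norm (?I (\<lambda>z. ?g z - \<phi> w * of_real (delta_kernel e w z))) \<le>
        ?I (\<lambda>z. t * delta_kernel e w z + e * K)"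
      by (intro integral_norm_bound_integral i continuous_intros c\<phi> cd pt)
    also have "\<dots> = t * m + e * Q"
      by (subst integral_add; (intro i continuous_intros cd)?) (simp add: content m_def Q_def)
    also have "?I (\<lambda>z. ?g z - \<phi> w * of_real (delta_kernel e w z)) = ?I ?g - \<phi> w * of_real m"
    proof -
      have "?I (\<lambda>z. complex_of_real (delta_kernel e w z)) = of_real m"
        unfolding m_def using integral_linear[OF i[OF cd[of strip]] bounded_linear_of_real, of "p - L" "p + L" w]
        by (simp add: o_def)
      then show ?thesis
        by (subst integral_diff; (intro i continuous_intros c\<phi> cd)?) simp
    qed
    finally have "norm (\<phi> w * of_real m) \<le> norm (?I ?g) + (t * m + e * Q)"
      using norm_triangle_ineq2[of "\<phi> w * of_real m" "?I ?g"]
      by (simp add: norm_minus_commute)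
    then have "norm (\<phi> w) * m \<le> B + e * Q + t * m"
      using bd[OF e] m by (simp add: norm_mult w_def)
    then have "(norm (\<phi> w) - t) * m \<le> B + e * Q" by (simp add: algebra_simps)
    then have "norm (\<phi> w) - t \<le> (B + e * Q) / m" using m by (simp add: pos_le_divide_eq)
    also have "\<dots> \<le> (B + e * Q) / (8 / 9)"
      using m B0 e Q0 by (intro divide_left_mono) auto
    finally show ?thesis using eQ by (simp add: t_def field_simps)
  qed
  then show ?thesis unfolding w_def by (rule field_le_epsilon)
qed

text \<open>
  The function \<open>G x = x (x\<^sup>2 + e)\<^bsup>- s / 4\<^esup>\<close> satisfies \<open>G' x \<ge> (1 - s / 2) (x\<^sup>2 + e)\<^bsup>- s / 4\<^esup>\<close> and
  \<open>\<bar>G x\<bar> \<le> \<bar>x\<bar>\<^bsup>1 - s / 2\<^esup>\<close>. The bound does not depend on \<open>e\<close>, which replaces the integrability of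
  \<open>\<bar>x\<bar>\<^bsup>- s / 2\<^esup>\<close> at \<open>0\<close>.
\<close>

lemma integral_regularised_power_le:
  fixes s e :: real
  assumes s: "0 < s" "s < 2" and e: "e > 0" and \<alpha>: "- R \<le> \<alpha>" "\<alpha> \<le> 0" and \<beta>: "0 \<le> \<beta>" "\<beta> \<le> R"
  shows "integral {\<alpha>..\<beta>} (\<lambda>x. (x\<^sup>2 + e) powr (- s / 4)) \<le> 2 * R powr (1 - s / 2) / (1 - s / 2)"
proof -
  define G where "G x = x * (x\<^sup>2 + e) powr (- s / 4)" for x :: real
  define G' where "G' x = (x\<^sup>2 + e) powr (- s / 4) + x * ((- s / 4) * (x\<^sup>2 + e) powr (- s / 4 - 1) * (2 * x))"
    for x :: real
  have N: "x\<^sup>2 + e > 0" for x :: real using e by (simp add: add_nonneg_pos)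
  have dG: "(G has_real_derivative G' x) (at x)" for x
  proof -
    have "((\<lambda>x. (x\<^sup>2 + e) powr (- s / 4)) has_real_derivative
        (- s / 4) * (x\<^sup>2 + e) powr (- s / 4 - 1) * (2 * x)) (at x)"
      by (rule DERIV_chain2[where f = "\<lambda>z. z powr (- s / 4)" and g = "\<lambda>x. x\<^sup>2 + e",
          OF has_real_derivative_powr[OF N]]) (auto intro!: derivative_eq_intros)
    from DERIV_mult[OF DERIV_ident this] show ?thesis
      unfolding G_def G'_def by (simp add: algebra_simps)
  qed
  have G'ge: "(1 - s / 2) * (x\<^sup>2 + e) powr (- s / 4) \<le> G' x" for x
  proof -
    have "x\<^sup>2 * (x\<^sup>2 + e) powr (- s / 4 - 1) = (x\<^sup>2 / (x\<^sup>2 + e)) * (x\<^sup>2 + e) powr (- s / 4)"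
      using N[of x] by (simp add: powr_diff)
    also have "\<dots> \<le> 1 * (x\<^sup>2 + e) powr (- s / 4)"
      using N[of x] e by (intro mult_right_mono) auto
    finally have "s / 2 * (x\<^sup>2 * (x\<^sup>2 + e) powr (- s / 4 - 1)) \<le> s / 2 * (x\<^sup>2 + e) powr (- s / 4)"
      using s by (intro mult_left_mono) auto
    then show ?thesis unfolding G'_def by (simp add: algebra_simps power2_eq_square)
  qed
  have Gle: "\<bar>G x\<bar> \<le> R powr (1 - s / 2)" if "\<bar>x\<bar> \<le> R" for x
  proof (cases "x = 0")
    case False
    have "(x\<^sup>2 + e) powr (- s / 4) \<le> (x\<^sup>2) powr (- s / 4)"
      using s e False by (intro powr_mono2') auto
    also have "(x\<^sup>2) powr (- s / 4) = \<bar>x\<bar> powr (- s / 2)"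
    proof -
      have "x\<^sup>2 = \<bar>x\<bar> powr 2" by simp
      then show ?thesis by (simp only: powr_powr) simp
    qed
    finally have "\<bar>G x\<bar> \<le> \<bar>x\<bar> * \<bar>x\<bar> powr (- s / 2)"
      by (simp add: G_def abs_mult mult_left_mono)
    also have "\<dots> = \<bar>x\<bar> powr (1 - s / 2)"
      using False powr_add[of "\<bar>x\<bar>" 1 "- s / 2"] by simp
    also have "\<dots> \<le> R powr (1 - s / 2)" using that s by (intro powr_mono2) auto
    finally show ?thesis .
  qed (simp add: G_def)
  have "((\<lambda>x. G' x) has_integral (G \<beta> - G \<alpha>)) {\<alpha>..\<beta>}"
    using \<alpha> \<beta> dG by (intro fundamental_theorem_of_calculus)
      (auto simp: has_real_derivative_iff_has_vector_derivative[symmetric] intro: has_field_derivative_at_within)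
  moreover have "(\<lambda>x. (1 - s / 2) * (x\<^sup>2 + e) powr (- s / 4)) integrable_on {\<alpha>..\<beta>}"
    using N by (intro integrable_continuous_real continuous_intros) (auto simp: less_imp_neq[symmetric])
  ultimately have "integral {\<alpha>..\<beta>} (\<lambda>x. (1 - s / 2) * (x\<^sup>2 + e) powr (- s / 4)) \<le> G \<beta> - G \<alpha>"
    using G'ge by (meson has_integral_le integrable_integral)
  also have "\<dots> \<le> 2 * R powr (1 - s / 2)"
    using Gle[of \<beta>] Gle[of \<alpha>] \<alpha> \<beta> by (simp add: abs_le_iff)
  finally show ?thesis using s by (simp add: pos_le_divide_eq mult.commute)
qed

text \<open>
  The kernel is in \<open>L\<^sup>s\<close> for \<open>s < 2\<close>, uniformly in \<open>e\<close>. Polar coordinates are avoided by the inequality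
  \<open>(a + b)\<^bsup>- s / 2\<^esup> \<le> a\<^bsup>- s / 4\<^esup> b\<^bsup>- s / 4\<^esup>\<close>, which separates the variables and still leaves
  integrable powers.
\<close>

lemma integral_kernel_power_le:
  assumes s: "0 < s" "s < 2" and e: "e > 0" and L: "L > 0" and q: "0 \<le> q" "q \<le> 1"
  shows "integral (rect (p - L) (p + L)) (\<lambda>z. (1 / sqrt (sqdist z (p, q) + e)) powr s) \<le>
    (2 * L powr (1 - s / 2) / (1 - s / 2)) * (2 / (1 - s / 2))"
proof -
  define A where "A x = (x\<^sup>2 + e / 2) powr (- s / 4)" for x :: real
  have N: "x\<^sup>2 + e / 2 > 0" for x :: real using e by (simp add: add_nonneg_pos)
  have cA: "continuous_on S A" for S
    unfolding A_def using N by (intro continuous_intros) (auto simp: less_imp_neq[symmetric])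
  have cA': "continuous_on S (\<lambda>z. A (h z))" if "continuous_on S h" for S :: "'b::topological_space set" and h
    by (rule continuous_on_compose2[OF cA that]) auto
  have pt: "(1 / sqrt (sqdist z (p, q) + e)) powr s \<le> A (fst z - p) * A (snd z - q)" for z
  proof -
    let ?a = "(fst z - p)\<^sup>2 + e / 2" and ?b = "(snd z - q)\<^sup>2 + e / 2"
    have ab: "?a > 0" "?b > 0" using N by auto
    have "(1 / sqrt x) powr s = x powr (- s / 2)" if "x > 0" for x
      using that by (simp add: powr_divide powr_minus_divide powr_powr flip: powr_half_sqrt)
    from this[of "?a + ?b"] have "(1 / sqrt (?a + ?b)) powr s = (?a + ?b) powr (- s / 2)"
      using ab by linarith
    moreover have eq: "sqdist z (p, q) + e = ?a + ?b" by (simp add: sqdist_def)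
    ultimately have "(1 / sqrt (sqdist z (p, q) + e)) powr s = (?a + ?b) powr (- s / 2)"
      by (simp only: eq)
    also have "\<dots> = ((?a + ?b)\<^sup>2) powr (- s / 4)"
    proof -
      have "(?a + ?b)\<^sup>2 = (?a + ?b) powr 2" using ab by simp
      then show ?thesis by (simp only: powr_powr) simp
    qed
    also have "\<dots> \<le> (?a * ?b) powr (- s / 4)"
    proof (rule powr_mono2')
      have "u * v \<le> (u + v)\<^sup>2" if "u > 0" "v > 0" for u v :: real
      proof -
        have "0 < u * v" "0 \<le> u\<^sup>2" "0 \<le> v\<^sup>2" using that by simp_all
        then show ?thesis unfolding power2_sum by linarith
      qed
      then show "?a * ?b \<le> (?a + ?b)\<^sup>2" using ab by blast
    qed (use ab s in auto)
    also have "\<dots> = A (fst z - p) * A (snd z - q)"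
      unfolding A_def by (rule powr_mult)
    finally show ?thesis .
  qed
  have cAA: "continuous_on S (\<lambda>z. A (fst z - p) * A (snd z - q))" for S :: "(real \<times> real) set"
    by (intro continuous_on_mult cA' continuous_intros)
  have sh: "integral {u - c..v - c} (\<lambda>x. A (x + c)) = integral {u..v} A" for u v c
    by (rule integral_shift_real_ivl)
  have Ax: "integral {p - L..p + L} (\<lambda>x. A (x - p)) \<le> 2 * L powr (1 - s / 2) / (1 - s / 2)"
    using sh[of "- L" "- p" L] integral_regularised_power_le[of s "e / 2" L "- L" L] s e L
    by (simp add: A_def[abs_def] add.commute)
  have Ay: "integral {0..1} (\<lambda>y. A (y - q)) \<le> 2 / (1 - s / 2)"
    using sh[of "- q" "- q" "1 - q"] integral_regularised_power_le[of s "e / 2" 1 "- q" "1 - q"] s e q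
    by (simp add: A_def[abs_def])
  have Ann: "A x \<ge> 0" for x by (simp add: A_def)
  have "integral (rect (p - L) (p + L)) (\<lambda>z. (1 / sqrt (sqdist z (p, q) + e)) powr s) \<le>
      integral (rect (p - L) (p + L)) (\<lambda>z. A (fst z - p) * A (snd z - q))"
    using e by (intro integral_le integrable_continuous cAA pt continuous_intros)
      (auto simp: less_imp_neq)
  also have "\<dots> = integral {p - L..p + L} (\<lambda>x. A (x - p)) * integral {0..1} (\<lambda>y. A (y - q))"
    unfolding integral_rect_iterated(1)[OF cAA] by simp
  also have "\<dots> \<le> (2 * L powr (1 - s / 2) / (1 - s / 2)) * (2 / (1 - s / 2))"
    by (intro mult_mono Ax Ay integral_nonneg Ann integrable_continuous_real cA' continuous_intros)
      (use s in auto)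
  finally show ?thesis .
qed

text \<open>
  \<open>f\<close> is localised by a cutoff \<open>\<eta>\<close> around \<open>(p, q)\<close> that vanishes at the wall farther from the point and at the
  vertical sides, and the reflection is made in the nearer wall. The only delicate term is
  \<open>f\<close> times the gradient of \<open>\<eta>\<close> times the kernel. Here \<open>\<eta>\<close> is built from quadratic functions with critical point
  \<open>(p, q)\<close>, so its gradient is \<open>O(\<bar>z - (p, q)\<bar>)\<close> and compensates the singularity of the kernel: this term costs
  no more than the \<open>L\<^sup>1\<close> norm of \<open>f\<close>. The other term is estimated by the Hoelder inequality, as
  \<open>r > 2\<close> makes the conjugate exponent \<open>s\<close> smaller than \<open>2\<close>.
\<close>

lemma sup_le_dbar:
  fixes r L :: real
  assumes r: "r > 2" and L: "L > 0"
  obtains C where "C > 0"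
    and "\<And>f f1 f2 p q. has_partials f f1 f2 \<Longrightarrow> (\<And>x. Im (f (x, 0)) = 0) \<Longrightarrow> (\<And>x. Im (f (x, 1)) = 0) \<Longrightarrow>
      0 < q \<Longrightarrow> q < 1 \<Longrightarrow> norm (f (p, q)) \<le>
        C * (integral (rect (p - L) (p + L)) (\<lambda>z. norm (f1 z + \<i> * f2 z) powr r) powr (1 / r)
          + integral (rect (p - L) (p + L)) (\<lambda>z. norm (f z)))"
proof
  define s where "s = r / (r - 1)"
  have s: "1 < s" "s < 2" "1 / r + 1 / s = 1"
    using r by (auto simp: s_def field_simps)
  define C1 where "C1 = ((2 * L powr (1 - s / 2) / (1 - s / 2)) * (2 / (1 - s / 2))) powr (1 / s)"
  define C2 where "C2 = 2 / L\<^sup>2 + 8"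
  have C12: "C1 \<ge> 0" "C2 > 0" using L by (auto simp: C1_def C2_def add_pos_pos)
  show "9 / 4 * (C1 + C2) > 0" using C12 by simp
  fix f f1 f2 :: "real \<times> real \<Rightarrow> complex" and p q :: real
  assume f: "has_partials f f1 f2" and wall: "\<And>x. Im (f (x, 0)) = 0" "\<And>x. Im (f (x, 1)) = 0"
    and q: "0 < q" "q < 1"
  let ?I = "integral (rect (p - L) (p + L))"
  let ?D = "\<lambda>z. f1 z + \<i> * f2 z"
  note cf = has_partialsD(3-5)[OF f]
  \<comment> \<open>The nearer wall; then \<open>h\<close> is the signed distance to the opposite wall, so \<open>\<bar>h\<bar> \<ge> 1 / 2\<close>.\<close>
  define b :: real where "b = (if q \<le> 1 / 2 then 0 else 1)"
  define h where "h = 1 - b - q"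
  have b: "b \<in> {0, 1}" by (simp add: b_def)
  have h: "\<bar>h\<bar> \<ge> 1 / 2" "h \<noteq> 0" using q by (auto simp: h_def b_def)
  have yh: "\<bar>y - q\<bar> \<le> \<bar>h\<bar>" if "0 \<le> y" "y \<le> 1" for y
    using that q by (auto simp: h_def b_def)
  define cx where "cx x = 1 - ((x - p) / L)\<^sup>2" for x
  define cy where "cy y = 1 - ((y - q) / h)\<^sup>2" for y
  define cx' where "cx' x = - (2 * (x - p) / L\<^sup>2)" for x
  define cy' where "cy' y = - (2 * (y - q) / h\<^sup>2)" for y
  have dx: "(cx has_real_derivative cx' x) (at x)" for x
    unfolding cx_def cx'_def using L by (auto intro!: derivative_eq_intros simp: power2_eq_square)
  have dy: "(cy has_real_derivative cy' y) (at y within S)" for y S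
    unfolding cy_def cy'_def using h by (auto intro!: derivative_eq_intros simp: power2_eq_square)
  define \<eta> where "\<eta> z = complex_of_real (cx (fst z) * cy (snd z))" for z :: "real \<times> real"
  define \<eta>1 where "\<eta>1 z = complex_of_real (cx' (fst z) * cy (snd z))" for z :: "real \<times> real"
  define \<eta>2 where "\<eta>2 z = complex_of_real (cx (fst z) * cy' (snd z))" for z :: "real \<times> real"
  have cc: "continuous_on A (\<lambda>z. cx (fst z))" "continuous_on A (\<lambda>z. cx' (fst z))"
      "continuous_on A (\<lambda>z. cy (snd z))" "continuous_on A (\<lambda>z. cy' (snd z))" for A :: "(real \<times> real) set"
    unfolding cx_def cx'_def cy_def cy'_def using L h by (auto intro!: continuous_intros)
  have \<eta>: "has_partials \<eta> \<eta>1 \<eta>2"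
  proof (rule has_partialsI)
    fix x y :: real
    show "((\<lambda>s. \<eta> (s, y)) has_vector_derivative \<eta>1 (x, y)) (at x)"
      unfolding \<eta>_def \<eta>1_def fst_conv snd_conv
      by (intro has_vector_derivative_of_real DERIV_cmult_right dx)
    show "((\<lambda>s. \<eta> (x, s)) has_vector_derivative \<eta>2 (x, y)) (at y within {0..1})"
      unfolding \<eta>_def \<eta>2_def fst_conv snd_conv
      by (intro has_vector_derivative_of_real DERIV_cmult dy)
  qed (unfold \<eta>_def \<eta>1_def \<eta>2_def, (intro continuous_intros cc)+)
  define \<phi> where "\<phi> z = \<eta> z * f z" for z
  define \<phi>1 where "\<phi>1 z = \<eta> z * f1 z + \<eta>1 z * f z" for z
  define \<phi>2 where "\<phi>2 z = \<eta> z * f2 z + \<eta>2 z * f z" for z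
  have \<phi>: "has_partials \<phi> \<phi>1 \<phi>2"
    unfolding \<phi>_def[abs_def] \<phi>1_def[abs_def] \<phi>2_def[abs_def] by (rule has_partials_mult[OF \<eta> f])
  note c\<phi> = has_partialsD(3-5)[OF \<phi>]
  have side: "\<phi> (p - L, y) = 0 \<and> \<phi> (p + L, y) = 0" for y
    using L by (simp add: \<phi>_def \<eta>_def cx_def power2_eq_square)
  have far: "\<phi> (x, 1 - b) = 0" for x
    using h by (simp add: \<phi>_def \<eta>_def cy_def h_def)
  have near: "Im (\<phi> (x, b)) = 0" for x
    using b wall by (auto simp: \<phi>_def \<eta>_def)
  have \<phi>pq: "\<phi> (p, q) = f (p, q)" by (simp add: \<phi>_def \<eta>_def cx_def cy_def)
  have bd: "norm (?I (\<lambda>z. \<phi> z * of_real (delta_kernel e (p, q) z)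
      + cnj (\<phi> z) * of_real (delta_kernel e (mirror b (p, q)) z))) \<le>
      2 * (C1 * ?I (\<lambda>z. norm (?D z) powr r) powr (1 / r) + C2 * ?I (\<lambda>z. norm (f z)))"
    if e: "e > 0" for e
  proof -
    define \<kappa> where "\<kappa> z = 1 / sqrt (sqdist z (p, q) + e)" for z
    have \<kappa>: "\<kappa> z \<ge> 0" for z using e by (simp add: \<kappa>_def)
    have c\<kappa>: "continuous_on A \<kappa>" for A
      unfolding \<kappa>_def using e by (intro continuous_intros) (auto simp: less_imp_neq)
    have X\<kappa>: "\<bar>u\<bar> * \<kappa> z \<le> 1" if "u\<^sup>2 \<le> sqdist z (p, q)" for u z
    proof -
      have "\<bar>u\<bar> \<le> sqrt (sqdist z (p, q) + e)"
        using that e by (intro real_le_rsqrt) simp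
      then show ?thesis using sqdist_pos(1)[OF e, of z "(p, q)"] by (simp add: \<kappa>_def)
    qed
    have pt: "norm (\<phi>1 z + \<i> * \<phi>2 z) * \<kappa> z \<le> norm (?D z) * \<kappa> z + C2 * norm (f z)"
      if z: "z \<in> rect (p - L) (p + L)" for z
    proof -
      obtain x y where xy: "z = (x, y)" "\<bar>x - p\<bar> \<le> L" "0 \<le> y" "y \<le> 1"
        using z by (cases z) (auto simp: cbox_Pair_eq)
      have "((x - p) / L)\<^sup>2 \<le> 1" "((y - q) / h)\<^sup>2 \<le> 1"
        using xy yh[of y] L h by (auto simp: abs_square_le_1)
      then have c01: "0 \<le> cx x" "cx x \<le> 1" "0 \<le> cy y" "cy y \<le> 1"
        by (auto simp: cx_def cy_def)
      have "\<bar>cx' x\<bar> * \<kappa> z = 2 / L\<^sup>2 * (\<bar>x - p\<bar> * \<kappa> z)"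
        unfolding cx'_def abs_minus_cancel abs_divide abs_mult by simp
      also have "\<dots> \<le> 2 / L\<^sup>2 * 1"
        by (intro mult_left_mono X\<kappa>) (auto simp: xy sqdist_def)
      finally have 1: "\<bar>cx' x\<bar> * \<kappa> z \<le> 2 / L\<^sup>2" by simp
      have "(1 / 2)\<^sup>2 \<le> h\<^sup>2" using h(1) by (simp add: abs_le_square_iff[symmetric])
      then have "2 / h\<^sup>2 \<le> 8" using h(2) by (simp add: divide_le_eq power2_eq_square)
      moreover have "\<bar>cy' y\<bar> * \<kappa> z = 2 / h\<^sup>2 * (\<bar>y - q\<bar> * \<kappa> z)"
        unfolding cy'_def abs_minus_cancel abs_divide abs_mult by simp
      moreover have "\<dots> \<le> 2 / h\<^sup>2 * 1"
        by (intro mult_left_mono X\<kappa>) (auto simp: xy sqdist_def)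
      ultimately have 2: "\<bar>cy' y\<bar> * \<kappa> z \<le> 8" by simp
      have n: "norm (\<eta> z) = cx x * cy y" "norm (\<eta>1 z) = \<bar>cx' x\<bar> * cy y" "norm (\<eta>2 z) = cx x * \<bar>cy' y\<bar>"
        using c01 by (simp_all add: \<eta>_def \<eta>1_def \<eta>2_def xy norm_mult abs_mult)
      have "\<phi>1 z + \<i> * \<phi>2 z = \<eta> z * ?D z + (\<eta>1 z * f z + \<i> * \<eta>2 z * f z)"
        by (simp add: \<phi>1_def \<phi>2_def algebra_simps)
      then have "norm (\<phi>1 z + \<i> * \<phi>2 z) \<le> norm (\<eta> z * ?D z) + (norm (\<eta>1 z * f z) + norm (\<i> * \<eta>2 z * f z))"
        by (metis add_left_mono norm_triangle_ineq order_trans)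
      also have "\<dots> = cx x * cy y * norm (?D z) + (\<bar>cx' x\<bar> * cy y + cx x * \<bar>cy' y\<bar>) * norm (f z)"
        unfolding norm_mult n norm_ii by (simp add: distrib_right)
      also have "\<dots> \<le> 1 * norm (?D z) + (\<bar>cx' x\<bar> * 1 + 1 * \<bar>cy' y\<bar>) * norm (f z)"
        using c01 by (intro add_mono mult_right_mono mult_left_mono mult_le_one) auto
      finally have "norm (\<phi>1 z + \<i> * \<phi>2 z) * \<kappa> z \<le>
          (norm (?D z) + (\<bar>cx' x\<bar> + \<bar>cy' y\<bar>) * norm (f z)) * \<kappa> z"
        using \<kappa> by (intro mult_right_mono) auto
      also have "\<dots> = norm (?D z) * \<kappa> z + (\<bar>cx' x\<bar> * \<kappa> z + \<bar>cy' y\<bar> * \<kappa> z) * norm (f z)"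
        by (simp add: algebra_simps)
      also have "\<dots> \<le> norm (?D z) * \<kappa> z + C2 * norm (f z)"
        using 1 2 by (intro add_left_mono mult_right_mono) (auto simp: C2_def)
      finally show ?thesis .
    qed
    have "norm (?I (\<lambda>z. \<phi> z * of_real (delta_kernel e (p, q) z)
        + cnj (\<phi> z) * of_real (delta_kernel e (mirror b (p, q)) z))) \<le>
        2 * ?I (\<lambda>z. norm (\<phi>1 z + \<i> * \<phi>2 z) * \<kappa> z)"
      unfolding \<kappa>_def
      by (rule reflected_Cauchy_Pompeiu[OF \<phi> _ e b _ far near]) (use L side q in auto)
    also have "?I (\<lambda>z. norm (\<phi>1 z + \<i> * \<phi>2 z) * \<kappa> z) \<le> ?I (\<lambda>z. norm (?D z) * \<kappa> z + C2 * norm (f z))"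
      by (intro integral_le integrable_on_rect continuous_intros c\<phi> cf c\<kappa> pt)
    also have "\<dots> = ?I (\<lambda>z. norm (?D z) * \<kappa> z) + C2 * ?I (\<lambda>z. norm (f z))"
      by (subst integral_add; (intro integrable_on_rect continuous_intros cf c\<kappa>)?) simp
    finally have main: "norm (?I (\<lambda>z. \<phi> z * of_real (delta_kernel e (p, q) z)
        + cnj (\<phi> z) * of_real (delta_kernel e (mirror b (p, q)) z))) \<le>
        2 * (?I (\<lambda>z. norm (?D z) * \<kappa> z) + C2 * ?I (\<lambda>z. norm (f z)))"
      by simp
    have "?I (\<lambda>z. norm (?D z) * \<kappa> z) \<le>
        ?I (\<lambda>z. norm (?D z) powr r) powr (1 / r) * ?I (\<lambda>z. \<kappa> z powr s) powr (1 / s)"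
      by (rule integral_Holder)
        (use r s \<kappa> in \<open>auto intro!: continuous_on_subset[OF _ rect_subset_strip] continuous_intros cf c\<kappa>\<close>)
    also have "\<dots> \<le> ?I (\<lambda>z. norm (?D z) powr r) powr (1 / r) * C1"
      unfolding C1_def \<kappa>_def
    proof (intro mult_left_mono powr_mono2)
      have "continuous_on strip (\<lambda>z. \<kappa> z powr s)"
        using \<kappa> s by (intro continuous_on_powr' c\<kappa> continuous_on_const) auto
      then show "0 \<le> ?I (\<lambda>z. (1 / sqrt (sqdist z (p, q) + e)) powr s)"
        unfolding \<kappa>_def by (intro integral_nonneg integrable_on_rect) auto
    qed (use integral_kernel_power_le[of s e L q p] s e L q in auto)
    finally show ?thesis using main by (simp add: mult.commute[of C1])
  qed
  have nn: "0 \<le> ?I (\<lambda>z. norm (?D z) powr r) powr (1 / r)" "0 \<le> ?I (\<lambda>z. norm (f z))"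
    by (auto intro!: integral_nonneg integrable_on_rect continuous_intros cf)
  have "norm (f (p, q)) \<le> 9 / 8 * (2 * (C1 * ?I (\<lambda>z. norm (?D z) powr r) powr (1 / r) + C2 * ?I (\<lambda>z. norm (f z))))"
    using delta_kernel_concentrates[OF c\<phi>(1) L b q bd] by (simp add: \<phi>pq)
  also have "\<dots> = 9 / 4 * (C1 * ?I (\<lambda>z. norm (?D z) powr r) powr (1 / r) + C2 * ?I (\<lambda>z. norm (f z)))"
    by simp
  also have "\<dots> \<le> 9 / 4 * ((C1 + C2) * ?I (\<lambda>z. norm (?D z) powr r) powr (1 / r) + (C1 + C2) * ?I (\<lambda>z. norm (f z)))"
    using nn C12 by (intro mult_left_mono add_mono mult_right_mono) auto
  finally show "norm (f (p, q)) \<le>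
      9 / 4 * (C1 + C2) * (?I (\<lambda>z. norm (?D z) powr r) powr (1 / r) + ?I (\<lambda>z. norm (f z)))"
    by (simp only: mult.assoc distrib_left distrib_right)
qed

section \<open>Bounding the velocity by the vorticity\<close>

definition L2 :: "real \<Rightarrow> (real \<times> real \<Rightarrow> 'a::real_normed_vector) \<Rightarrow> real"
  where "L2 \<Gamma> f = sqrt (integral (rect 0 \<Gamma>) (\<lambda>z. (norm (f z))\<^sup>2))"

lemma L2_nonneg:
  assumes "continuous_on strip f"
  shows "0 \<le> L2 \<Gamma> f" "(L2 \<Gamma> f)\<^sup>2 = integral (rect 0 \<Gamma>) (\<lambda>z. (norm (f z))\<^sup>2)"
proof -
  have "0 \<le> integral (rect 0 \<Gamma>) (\<lambda>z. (norm (f z))\<^sup>2)"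
    by (intro integral_nonneg integrable_on_rect continuous_intros assms) auto
  then show "0 \<le> L2 \<Gamma> f" "(L2 \<Gamma> f)\<^sup>2 = integral (rect 0 \<Gamma>) (\<lambda>z. (norm (f z))\<^sup>2)"
    by (simp_all add: L2_def)
qed

lemma integral_inner_le_L2:
  fixes f g :: "real \<times> real \<Rightarrow> 'a::real_inner"
  assumes f: "continuous_on strip f" and g: "continuous_on strip g"
  shows "\<bar>integral (rect 0 \<Gamma>) (\<lambda>z. f z \<bullet> g z)\<bar> \<le> L2 \<Gamma> f * L2 \<Gamma> g"
proof -
  let ?I = "integral (rect 0 \<Gamma>)"
  have "norm (?I (\<lambda>z. f z \<bullet> g z)) \<le> ?I (\<lambda>z. \<bar>norm (f z) * norm (g z)\<bar>)"
    using Cauchy_Schwarz_ineq2[of "f z" "g z" for z]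
    by (intro integral_norm_bound_integral integrable_on_rect continuous_intros f g) (auto simp: abs_mult)
  also have "\<dots> \<le> L2 \<Gamma> f * L2 \<Gamma> g"
    unfolding L2_def
    by (intro integral_Cauchy_Schwarz continuous_intros continuous_on_subset[OF _ rect_subset_strip] f g)
  finally show ?thesis by simp
qed

lemma L2_mono:
  assumes "continuous_on strip f" "continuous_on strip g" "\<And>z. z \<in> strip \<Longrightarrow> norm (f z) \<le> norm (g z)"
  shows "L2 \<Gamma> f \<le> L2 \<Gamma> g"
  unfolding L2_def
  using assms rect_subset_strip[of 0 \<Gamma>]
  by (intro real_sqrt_le_mono integral_le integrable_on_rect continuous_intros power_mono) auto

lemma norm_pair_square: "(norm (a, b :: real))\<^sup>2 = a\<^sup>2 + (b :: real)\<^sup>2" for a :: real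
  by (simp add: norm_prod_def)

lemma Poincare_L2:
  fixes g :: "real \<times> real \<Rightarrow> real"
  assumes \<Gamma>: "\<Gamma> > 0" and g: "has_partials g g1 g2" and mean: "integral (rect 0 \<Gamma>) g = 0"
  shows "L2 \<Gamma> g \<le> sqrt (2 * \<Gamma>\<^sup>2 + 2) * L2 \<Gamma> (\<lambda>z. (g1 z, g2 z))"
proof -
  let ?I = "integral (rect 0 \<Gamma>)"
  note cg = has_partialsD(3-5)[OF g]
  have nn: "0 \<le> ?I (\<lambda>z. (g1 z)\<^sup>2)" "0 \<le> ?I (\<lambda>z. (g2 z)\<^sup>2)"
    by (intro integral_nonneg integrable_on_rect continuous_intros cg; simp)+
  have "?I (\<lambda>z. (g z)\<^sup>2) \<le> 2 * \<Gamma>\<^sup>2 * ?I (\<lambda>z. (g1 z)\<^sup>2) + 2 * ?I (\<lambda>z. (g2 z)\<^sup>2)"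
    by (rule Poincare_mean_zero[OF \<Gamma> g mean])
  also have "\<dots> \<le> (2 * \<Gamma>\<^sup>2 + 2) * ?I (\<lambda>z. (g1 z)\<^sup>2) + (2 * \<Gamma>\<^sup>2 + 2) * ?I (\<lambda>z. (g2 z)\<^sup>2)"
    using nn by (intro add_mono mult_right_mono) auto
  also have "\<dots> = (2 * \<Gamma>\<^sup>2 + 2) * ?I (\<lambda>z. (norm (g1 z, g2 z))\<^sup>2)"
    unfolding norm_pair_square
    by (subst integral_add; (intro integrable_on_rect continuous_intros cg)?) (simp add: distrib_left)
  finally show ?thesis
    unfolding L2_def real_norm_def power2_abs real_sqrt_mult[symmetric] by (rule real_sqrt_le_mono)
qed

text \<open>
  Pointwise, \<open>\<bar>\<nabla>u\<bar>\<^sup>2\<close> and \<open>\<omega>\<^sup>2\<close> differ by twice the Jacobian of \<open>v\<close> and \<open>w\<close>, up to multiples of the divergence. The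
  Jacobian integrates to zero as \<open>w\<close> vanishes on the walls.
\<close>

lemma dirichlet_eq_enstrophy:
  fixes v w :: "real \<times> real \<Rightarrow> real"
  assumes \<Gamma>: "\<Gamma> > 0" and v: "has_partials v v1 v2" "periodic_x \<Gamma> v"
    and w: "has_partials w w1 w2" "periodic_x \<Gamma> w"
    and div: "\<And>z. z \<in> strip \<Longrightarrow> v1 z + w2 z = 0"
    and wall: "\<And>x. w (x, 0) = 0" "\<And>x. w (x, 1) = 0"
  shows "L2 \<Gamma> (\<lambda>z. ((v1 z, v2 z), (w1 z, w2 z))) = L2 \<Gamma> (\<lambda>z. w1 z - v2 z)"
proof -
  let ?I = "integral (rect 0 \<Gamma>)"
  note c = has_partialsD(3-5)[OF v(1)] has_partialsD(3-5)[OF w(1)]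
  have J: "?I (\<lambda>z. v1 z * w2 z - v2 z * w1 z) = 0"
    using integral_jacobian[OF \<Gamma> v w] by (simp add: wall)
  have "?I (\<lambda>z. (norm ((v1 z, v2 z), (w1 z, w2 z)))\<^sup>2) =
      ?I (\<lambda>z. (w1 z - v2 z)\<^sup>2 - 2 * (v1 z * w2 z - v2 z * w1 z))"
  proof (rule integral_cong)
    fix z assume "z \<in> rect 0 \<Gamma>"
    then have "v1 z + w2 z = 0" using div rect_subset_strip by blast
    then have "w2 z = - v1 z" by simp
    then show "(norm ((v1 z, v2 z), (w1 z, w2 z)))\<^sup>2 =
        (w1 z - v2 z)\<^sup>2 - 2 * (v1 z * w2 z - v2 z * w1 z)"
      by (simp add: norm_prod_def power2_eq_square algebra_simps)
  qed
  also have "\<dots> = ?I (\<lambda>z. (w1 z - v2 z)\<^sup>2)"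
  proof -
    have "?I (\<lambda>z. (w1 z - v2 z)\<^sup>2 - 2 * (v1 z * w2 z - v2 z * w1 z)) =
        ?I (\<lambda>z. (w1 z - v2 z)\<^sup>2) - ?I (\<lambda>z. 2 * (v1 z * w2 z - v2 z * w1 z))"
      by (intro integral_diff integrable_on_rect continuous_intros c)
    then show ?thesis by (simp only: integral_mult_right J)
  qed
  finally show ?thesis by (simp add: L2_def)
qed

lemma L2_le_Lr:
  fixes g :: "real \<times> real \<Rightarrow> real"
  assumes \<Gamma>: "\<Gamma> > 0" and r: "r > 2" and g: "continuous_on strip g"
  shows "L2 \<Gamma> g \<le> \<Gamma> powr (1 / 2 - 1 / r) * integral (rect 0 \<Gamma>) (\<lambda>z. \<bar>g z\<bar> powr r) powr (1 / r)"
proof -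
  let ?I = "integral (rect 0 \<Gamma>)"
  have nn: "0 \<le> ?I (\<lambda>z. \<bar>g z\<bar> powr r)"
    using r by (intro integral_nonneg integrable_on_rect continuous_on_powr' continuous_intros g) auto
  have "?I (\<lambda>z. (g z)\<^sup>2 * 1) \<le>
      ?I (\<lambda>z. (g z)\<^sup>2 powr (r / 2)) powr (1 / (r / 2)) * ?I (\<lambda>z. 1 powr (r / (r - 2))) powr (1 / (r / (r - 2)))"
  proof (rule integral_Holder)
    show "continuous_on (rect 0 \<Gamma>) (\<lambda>z. (g z)\<^sup>2)"
      by (intro continuous_on_subset[OF _ rect_subset_strip] continuous_intros g)
    show "r / 2 > 1" "r / (r - 2) > 1" "1 / (r / 2) + 1 / (r / (r - 2)) = 1"
      using r by (simp_all add: field_simps)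
  qed auto
  also have "(\<lambda>z. (g z)\<^sup>2 powr (r / 2)) = (\<lambda>z. \<bar>g z\<bar> powr r)"
  proof
    fix z
    have "(g z)\<^sup>2 = \<bar>g z\<bar> powr 2" by simp
    then show "(g z)\<^sup>2 powr (r / 2) = \<bar>g z\<bar> powr r" by (simp only: powr_powr) simp
  qed
  also have "?I (\<lambda>z. 1 powr (r / (r - 2))) powr (1 / (r / (r - 2))) = \<Gamma> powr (1 - 2 / r)"
    using \<Gamma> r by (simp add: content_Pair diff_divide_distrib)
  finally have "L2 \<Gamma> g \<le> sqrt (?I (\<lambda>z. \<bar>g z\<bar> powr r) powr (2 / r) * \<Gamma> powr (1 - 2 / r))"
    by (simp add: L2_def)
  also have "\<dots> = ?I (\<lambda>z. \<bar>g z\<bar> powr r) powr (2 / r / 2) * \<Gamma> powr ((1 - 2 / r) / 2)"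
  proof -
    have "sqrt (x powr a) = x powr (a / 2)" for x a :: real
      using powr_half_sqrt[of "x powr a"] by (simp add: powr_powr)
    then show ?thesis by (simp only: real_sqrt_mult)
  qed
  also have "\<dots> = \<Gamma> powr (1 / 2 - 1 / r) * ?I (\<lambda>z. \<bar>g z\<bar> powr r) powr (1 / r)"
    using r by (simp add: diff_divide_distrib)
  finally show ?thesis .
qed

text \<open>
  The constant \<open>m\<close> is the mean of \<open>v\<close>; it cannot be avoided, since a uniform horizontal flow has no vorticity.
  The \<open>L\<^sup>1\<close> norm left over by \<open>sup_le_dbar\<close> is controlled by the Poincare inequality.
\<close>

lemma velocity_sup_le_vorticity:
  fixes \<Gamma> r :: real
  assumes \<Gamma>: "\<Gamma> > 0" and r: "r > 2"
  obtains C where "C > 0"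
    and "\<And>v v1 v2 w w1 w2. has_partials v v1 v2 \<Longrightarrow> periodic_x \<Gamma> v \<Longrightarrow> has_partials w w1 w2 \<Longrightarrow> periodic_x \<Gamma> w \<Longrightarrow>
      (\<And>z. z \<in> strip \<Longrightarrow> v1 z + w2 z = 0) \<Longrightarrow> (\<And>x. w (x, 0) = 0) \<Longrightarrow> (\<And>x. w (x, 1) = 0) \<Longrightarrow>
      \<exists>m. \<forall>z\<in>strip. norm (v z - m, w z) \<le>
        C * integral (rect 0 \<Gamma>) (\<lambda>z. \<bar>w1 z - v2 z\<bar> powr r) powr (1 / r)"
proof -
  let ?I = "integral (rect 0 \<Gamma>)"
  \<comment> \<open>With \<open>L = \<Gamma> / 2\<close> the window of integration in \<open>sup_le_dbar\<close> is exactly one period.\<close>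
  have h: "\<Gamma> / 2 > 0" using \<Gamma> by simp
  show thesis
  proof (rule sup_le_dbar[OF r h])
    fix C assume C: "C > 0" and sup: "\<And>f f1 f2 p q. has_partials f f1 f2 \<Longrightarrow>
        (\<And>x. Im (f (x, 0)) = 0) \<Longrightarrow> (\<And>x. Im (f (x, 1)) = 0) \<Longrightarrow> 0 < q \<Longrightarrow> q < 1 \<Longrightarrow> norm (f (p, q)) \<le>
          C * (integral (rect (p - \<Gamma> / 2) (p + \<Gamma> / 2)) (\<lambda>z. norm (f1 z + \<i> * f2 z) powr r) powr (1 / r)
            + integral (rect (p - \<Gamma> / 2) (p + \<Gamma> / 2)) (\<lambda>z. norm (f z)))"
    define K where "K = 2 * (sqrt \<Gamma> * (sqrt (2 * \<Gamma>\<^sup>2 + 2) * \<Gamma> powr (1 / 2 - 1 / r)))"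
    have K: "K \<ge> 0" using \<Gamma> by (simp add: K_def)
    show thesis
    proof (rule that)
      show "C * (1 + K) > 0" using C K by simp
      fix v v1 v2 w w1 w2 :: "real \<times> real \<Rightarrow> real"
      assume v: "has_partials v v1 v2" "periodic_x \<Gamma> v" and w: "has_partials w w1 w2" "periodic_x \<Gamma> w"
        and div: "\<And>z. z \<in> strip \<Longrightarrow> v1 z + w2 z = 0" and wall: "\<And>x. w (x, 0) = 0" "\<And>x. w (x, 1) = 0"
      note c = has_partialsD(3-5)[OF v(1)] has_partialsD(3-5)[OF w(1)]
      define m where "m = ?I v / \<Gamma>"
      define W where "W = ?I (\<lambda>z. \<bar>w1 z - v2 z\<bar> powr r) powr (1 / r)"
      have content: "Henstock_Kurzweil_Integration.content (rect 0 \<Gamma>) = \<Gamma>"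
        using \<Gamma> by (simp add: content_Pair)
      have vm: "has_partials (\<lambda>z. v z - m) v1 v2"
        using has_partials_diff[OF v(1) has_partials_const[of m]] by simp
      have mean_v: "?I (\<lambda>z. v z - m) = 0"
        by (subst integral_diff; (intro integrable_on_rect continuous_intros c)?)
          (use \<Gamma> in \<open>simp add: content m_def\<close>)
      have height: "has_partials (\<lambda>z. snd z) (\<lambda>_. 0) (\<lambda>_. 1 :: real)"
        by (rule has_partialsI) (auto intro!: continuous_intros derivative_eq_intros)
      \<comment> \<open>\<open>\<integral>w\<close> is the pairing of the velocity with the gradient of the height function.\<close>
    have mean_w: "?I w = 0"
        using integral_grad_orthogonal[OF \<Gamma> height _ v w(1) div wall] by (simp add: periodic_x_def)
      have grad: "L2 \<Gamma> (\<lambda>z. (g1 z, g2 z)) \<le> \<Gamma> powr (1 / 2 - 1 / r) * W"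
        if "(g1, g2) \<in> {(v1, v2), (w1, w2)}" for g1 g2
      proof -
        have "L2 \<Gamma> (\<lambda>z. (g1 z, g2 z)) \<le> L2 \<Gamma> (\<lambda>z. ((v1 z, v2 z), (w1 z, w2 z)))"
          using that by (intro L2_mono) (auto intro!: continuous_intros c simp: norm_prod_def)
        also have "\<dots> = L2 \<Gamma> (\<lambda>z. w1 z - v2 z)"
          by (rule dirichlet_eq_enstrophy[OF \<Gamma> v w div wall])
        also have "\<dots> \<le> \<Gamma> powr (1 / 2 - 1 / r) * W"
          unfolding W_def by (intro L2_le_Lr \<Gamma> r continuous_intros c)
        finally show ?thesis .
      qed
      have L1: "?I (\<lambda>z. \<bar>g z\<bar>) \<le> K / 2 * W"
        if g: "has_partials g g1 g2" "?I g = 0" "(g1, g2) \<in> {(v1, v2), (w1, w2)}" for g g1 g2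
      proof -
        note cg = has_partialsD(3)[OF g(1)]
        have "?I (\<lambda>z. \<bar>g z\<bar>) \<le> \<bar>?I (\<lambda>z. 1 \<bullet> \<bar>g z\<bar>)\<bar>" by simp
        also have "\<dots> \<le> L2 \<Gamma> (\<lambda>_. 1 :: real) * L2 \<Gamma> (\<lambda>z. \<bar>g z\<bar>)"
          by (intro integral_inner_le_L2 continuous_intros cg)
        also have "\<dots> = sqrt \<Gamma> * L2 \<Gamma> g" by (simp add: L2_def content)
        also have "\<dots> \<le> sqrt \<Gamma> * (sqrt (2 * \<Gamma>\<^sup>2 + 2) * L2 \<Gamma> (\<lambda>z. (g1 z, g2 z)))"
          using \<Gamma> by (intro mult_left_mono Poincare_L2[OF \<Gamma> g(1,2)]) auto
        also have "\<dots> \<le> sqrt \<Gamma> * (sqrt (2 * \<Gamma>\<^sup>2 + 2) * (\<Gamma> powr (1 / 2 - 1 / r) * W))"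
          using \<Gamma> by (intro mult_left_mono grad g(3)) auto
        finally show ?thesis by (simp add: K_def)
      qed
      define f where "f z = of_real (v z - m) - \<i> * of_real (w z)" for z
      define f1 where "f1 z = of_real (v1 z) - \<i> * of_real (w1 z)" for z
      define f2 where "f2 z = of_real (v2 z) - \<i> * of_real (w2 z)" for z
      have f: "has_partials f f1 f2"
        unfolding f_def[abs_def] f1_def[abs_def] f2_def[abs_def]
        using has_partials_diff[OF has_partials_bounded_linear[OF bounded_linear_of_real vm]
            has_partials_bounded_linear[OF bounded_linear_mult_right[of \<i>]
              has_partials_bounded_linear[OF bounded_linear_of_real w(1)]]] .
      have nf: "norm (f z) = norm (v z - m, w z)" for z
        by (simp add: f_def cmod_def norm_prod_def)
      have D: "norm (f1 z + \<i> * f2 z) = \<bar>w1 z - v2 z\<bar>" if "z \<in> strip" for z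
      proof -
        have "w2 z = - v1 z" using div[OF that] by simp
        then have "f1 z + \<i> * f2 z = \<i> * of_real (v2 z - w1 z)"
          by (simp add: f1_def f2_def complex_eq_iff)
        then show ?thesis by (simp only: norm_mult norm_ii norm_of_real) simp
      qed
      have int: "norm (f (p, q)) \<le> C * (1 + K) * W" if q: "0 < q" "q < 1" for p q
      proof -
        let ?J = "integral (rect (p - \<Gamma> / 2) (p + \<Gamma> / 2))"
        have shift: "?J h = ?I h" if "continuous_on strip h" "periodic_x \<Gamma> h" for h :: "real \<times> real \<Rightarrow> real"
          using integral_rect_periodic[OF that \<Gamma>, of "p - \<Gamma> / 2"] by (simp add: field_simps)
        have "?J (\<lambda>z. norm (f1 z + \<i> * f2 z) powr r) = ?J (\<lambda>z. \<bar>w1 z - v2 z\<bar> powr r)"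
          using rect_subset_strip by (intro integral_cong) (metis D subsetD)
        also have "\<dots> = ?I (\<lambda>z. \<bar>w1 z - v2 z\<bar> powr r)"
          by (intro shift continuous_on_powr' continuous_intros c)
            (use r periodic_x_partials(2)[OF v] periodic_x_partials(1)[OF w] in \<open>auto simp: periodic_x_def\<close>)
        finally have 1: "?J (\<lambda>z. norm (f1 z + \<i> * f2 z) powr r) powr (1 / r) = W" by (simp add: W_def)
        have "?J (\<lambda>z. norm (f z)) = ?I (\<lambda>z. norm (f z))"
          by (intro shift continuous_intros has_partialsD(3)[OF f])
            (use v(2) w(2) in \<open>auto simp: periodic_x_def f_def\<close>)
        also have "\<dots> \<le> ?I (\<lambda>z. \<bar>v z - m\<bar> + \<bar>w z\<bar>)"
          unfolding nf by (intro integral_le integrable_on_rect continuous_intros c)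
            (rule norm_Pair_le[where 'a = real and 'b = real, unfolded real_norm_def])
        also have "\<dots> = ?I (\<lambda>z. \<bar>v z - m\<bar>) + ?I (\<lambda>z. \<bar>w z\<bar>)"
          by (intro integral_add integrable_on_rect continuous_intros c)
        also have "\<dots> \<le> K / 2 * W + K / 2 * W"
          by (intro add_mono L1[OF vm mean_v] L1[OF w(1) mean_w]) auto
        finally have 2: "?J (\<lambda>z. norm (f z)) \<le> K * W" by simp
        have "norm (f (p, q)) \<le> C * (?J (\<lambda>z. norm (f1 z + \<i> * f2 z) powr r) powr (1 / r) + ?J (\<lambda>z. norm (f z)))"
          by (rule sup[OF f]) (use q wall in \<open>auto simp: f_def\<close>)
        also have "\<dots> \<le> C * (W + K * W)"
          unfolding 1 using C 2 by (intro mult_left_mono add_left_mono) auto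
        finally show ?thesis by (simp add: algebra_simps)
      qed
      have "norm (f (p, q)) \<le> C * (1 + K) * W" if q: "q \<in> {0..1}" for p q
      proof (rule continuous_on_closure_norm_le[of "{0<..<1}" "\<lambda>q. f (p, q)"])
        show "continuous_on (closure {0<..<1}) (\<lambda>q. f (p, q))"
          by (intro continuous_on_strip_compose[OF has_partialsD(3)[OF f]]) (auto intro!: continuous_intros)
      qed (use int q in auto)
      then have "\<forall>z\<in>strip. norm (v z - m, w z) \<le> C * (1 + K) * W"
        unfolding nf[symmetric] by auto
      then show "\<exists>m. \<forall>z\<in>strip. norm (v z - m, w z) \<le>
          C * (1 + K) * ?I (\<lambda>z. \<bar>w1 z - v2 z\<bar> powr r) powr (1 / r)"
        unfolding W_def by blast
    qed
  qed
qed

section \<open>The terms of the momentum equation\<close>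

text \<open>
  Here \<open>\<beta>\<close> is the inverse slip length. In the proof, \<open>\<omega>\<close> is replaced by \<open>\<beta> g\<close>: both have the same wall values,
  hence the same Jacobian integral with \<open>p\<close>, but \<open>g\<close> contains no derivative of the velocity.
\<close>

lemma viscous_term_bound:
  fixes p v w :: "real \<times> real \<Rightarrow> real"
  assumes \<Gamma>: "\<Gamma> > 0" and \<beta>: "\<beta> \<ge> 0" and p: "has_partials p p1 p2" "periodic_x \<Gamma> p"
    and v: "has_partials v v1 v2" "periodic_x \<Gamma> v" and w: "has_partials w w1 w2" "periodic_x \<Gamma> w"
    and v1: "has_partials v1 v11 v12" and v2: "has_partials v2 v21 v22"
    and w1: "has_partials w1 w11 w12" and w2: "has_partials w2 w21 w22"
    and div: "\<And>z. z \<in> strip \<Longrightarrow> v1 z + w2 z = 0"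
    and wall: "\<And>x. w (x, 0) = 0" "\<And>x. w (x, 1) = 0"
    and slip: "\<And>x. v2 (x, 0) = \<beta> * v (x, 0)" "\<And>x. v2 (x, 1) = - \<beta> * v (x, 1)"
  shows "\<bar>integral (rect 0 \<Gamma>) (\<lambda>z. (p1 z, p2 z) \<bullet> (v11 z + v22 z, w11 z + w22 z))\<bar> \<le>
    \<beta> * ((2 * L2 \<Gamma> p + L2 \<Gamma> (\<lambda>z. (p1 z, p2 z))) * L2 \<Gamma> (\<lambda>z. (v2 z, w2 z)))"
proof -
  let ?I = "integral (rect 0 \<Gamma>)" and ?D = "L2 \<Gamma> (\<lambda>z. (v2 z, w2 z))"
  note c = has_partialsD(3-5)[OF p(1)] has_partialsD(3-5)[OF v(1)] has_partialsD(3-5)[OF w(1)]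
  define \<omega> where "\<omega> z = w1 z - v2 z" for z
  have \<omega>: "has_partials \<omega> (\<lambda>z. w11 z - v21 z) (\<lambda>z. w12 z - v22 z)"
    unfolding \<omega>_def[abs_def] by (rule has_partials_diff[OF w1 v2])
  have p\<omega>: "periodic_x \<Gamma> \<omega>"
    using periodic_x_partials(1)[OF w] periodic_x_partials(2)[OF v] by (simp add: \<omega>_def periodic_x_def)
  \<comment> \<open>\<open>\<Delta>u = (- \<partial>\<^sub>2\<omega>, \<partial>\<^sub>1\<omega>)\<close>\<close>
  have lap: "v11 z + v22 z = - (w12 z - v22 z)" "w11 z + w22 z = w11 z - v21 z" if z: "z \<in> strip" for z
  proof -
    have "v12 z = v21 z" "w12 z = w21 z"
      using z mixed_partials_commute[OF v(1) v1 v2] mixed_partials_commute[OF w(1) w1 w2]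
      by (cases z; auto)+
    moreover have "v11 z = - w21 z" "v12 z = - w22 z"
    proof -
      have m: "has_partials (\<lambda>z. - w2 z) (\<lambda>z. - w21 z) (\<lambda>z. - w22 z)"
        using has_partials_bounded_linear[OF bounded_linear_minus[OF bounded_linear_ident] w2] .
      have "v1 z = - w2 z" if "z \<in> strip" for z using div[OF that] by simp
      then show "v11 z = - w21 z" "v12 z = - w22 z"
        using partials_unique[OF v1 m _ z] by blast+
    qed
    ultimately show "v11 z + v22 z = - (w12 z - v22 z)" "w11 z + w22 z = w11 z - v21 z" by simp_all
  qed
  have w1_wall: "w1 (x, b) = 0" if "b \<in> {0, 1}" for x b
  proof -
    have "(\<lambda>s. w (s, b)) = (\<lambda>_. 0)" using that wall by auto
    then have "((\<lambda>_. 0 :: real) has_vector_derivative w1 (x, b)) (at x)"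
      using has_partialsD(1)[OF w(1), of b x] that by auto
    then show ?thesis using vector_derivative_unique_at has_vector_derivative_const by metis
  qed
  define g where "g z = (2 * snd z - 1) * v z" for z
  define g1 where "g1 z = (2 * snd z - 1) * v1 z" for z
  define g2 where "g2 z = (2 * snd z - 1) * v2 z + 2 * v z" for z
  have "has_partials (\<lambda>z. 2 * snd z - 1) (\<lambda>_. 0) (\<lambda>_. 2 :: real)"
    by (rule has_partialsI) (auto intro!: continuous_intros derivative_eq_intros)
  from has_partials_mult[OF this v(1)] have g: "has_partials g g1 g2"
    by (simp add: g_def[abs_def] g1_def[abs_def] g2_def[abs_def])
  have pg: "periodic_x \<Gamma> g" using v(2) by (simp add: periodic_x_def g_def)
  have "?I (\<lambda>z. (p1 z, p2 z) \<bullet> (v11 z + v22 z, w11 z + w22 z)) =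
      ?I (\<lambda>z. - (p1 z * (w12 z - v22 z) - p2 z * (w11 z - v21 z)))"
  proof (rule integral_cong)
    fix z assume "z \<in> rect 0 \<Gamma>"
    then have "z \<in> strip" using rect_subset_strip by blast
    then show "(p1 z, p2 z) \<bullet> (v11 z + v22 z, w11 z + w22 z) = - (p1 z * (w12 z - v22 z) - p2 z * (w11 z - v21 z))"
      by (simp only: inner_prod_def fst_conv snd_conv lap inner_real_def)
  qed
  also have "\<dots> = - ?I (\<lambda>z. p1 z * (w12 z - v22 z) - p2 z * (w11 z - v21 z))"
    by (rule integral_neg)
  also have "\<dots> = - (integral {0..\<Gamma>} (\<lambda>x. \<beta> * (p1 (x, 1) * g (x, 1)))
      - integral {0..\<Gamma>} (\<lambda>x. \<beta> * (p1 (x, 0) * g (x, 0))))"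
    unfolding integral_jacobian[OF \<Gamma> p \<omega> p\<omega>]
    by (simp add: \<omega>_def g_def w1_wall slip mult.left_commute)
  also have "\<dots> = - \<beta> * ?I (\<lambda>z. p1 z * g2 z - p2 z * g1 z)"
    unfolding integral_jacobian[OF \<Gamma> p g pg] integral_mult_right by (simp add: right_diff_distrib)
  finally have eq: "?I (\<lambda>z. (p1 z, p2 z) \<bullet> (v11 z + v22 z, w11 z + w22 z)) =
      - \<beta> * ?I (\<lambda>z. p1 z * g2 z - p2 z * g1 z)" .
  \<comment> \<open>The Jacobian of \<open>p\<close> and \<open>g\<close> is \<open>2 v \<partial>\<^sub>1p + \<nabla>p \<bullet> h\<close>; in the first summand \<open>\<partial>\<^sub>1\<close> is moved to \<open>v\<close>.\<close>
  define h where "h z = ((2 * snd z - 1) * v2 z, - ((2 * snd z - 1) * v1 z))" for z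
  have ch: "continuous_on strip h" unfolding h_def by (intro continuous_intros c)
  have "?I (\<lambda>z. p1 z * g2 z - p2 z * g1 z) = ?I (\<lambda>z. 2 * (p1 z * v z) + (p1 z, p2 z) \<bullet> h z)"
    by (intro integral_cong) (simp add: g1_def g2_def h_def algebra_simps)
  also have "\<dots> = ?I (\<lambda>z. 2 * (p1 z * v z)) + ?I (\<lambda>z. (p1 z, p2 z) \<bullet> h z)"
    by (intro integral_add integrable_on_rect continuous_intros c ch)
  also have "?I (\<lambda>z. 2 * (p1 z * v z)) = - (2 * ?I (\<lambda>z. p z \<bullet> v1 z))"
    unfolding integral_mult_right integral_by_parts_x[OF \<Gamma> p v] by simp
  finally have "\<bar>?I (\<lambda>z. p1 z * g2 z - p2 z * g1 z)\<bar> \<le>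
      2 * \<bar>?I (\<lambda>z. p z \<bullet> v1 z)\<bar> + \<bar>?I (\<lambda>z. (p1 z, p2 z) \<bullet> h z)\<bar>" by linarith
  also have "\<dots> \<le> 2 * (L2 \<Gamma> p * ?D) + L2 \<Gamma> (\<lambda>z. (p1 z, p2 z)) * ?D"
  proof (intro add_mono mult_left_mono)
    have v1w2: "\<bar>v1 z\<bar> = \<bar>w2 z\<bar>" if "z \<in> strip" for z using div[OF that] by linarith
    have "L2 \<Gamma> v1 \<le> ?D"
      by (intro L2_mono continuous_intros c) (simp add: v1w2 norm_prod_def)
    then show "\<bar>?I (\<lambda>z. p z \<bullet> v1 z)\<bar> \<le> L2 \<Gamma> p * ?D"
      using integral_inner_le_L2[OF c(1) c(5)] L2_nonneg(1)[OF c(1)]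
      by (meson mult_left_mono order_trans)
    have "L2 \<Gamma> h \<le> ?D"
    proof (intro L2_mono ch continuous_intros c)
      fix z :: "real \<times> real" assume z: "z \<in> strip"
      have "h z = (2 * snd z - 1) *\<^sub>R (v2 z, - v1 z)" by (simp add: h_def)
      then have "norm (h z) = \<bar>2 * snd z - 1\<bar> * norm (v2 z, - v1 z)" by (simp only: norm_scaleR)
      also have "norm (v2 z, - v1 z) = norm (v2 z, w2 z)"
        using v1w2[OF z] by (simp add: norm_prod_def power2_eq_iff[THEN iffD2] abs_eq_iff)
      also have "\<bar>2 * snd z - 1\<bar> * norm (v2 z, w2 z) \<le> 1 * norm (v2 z, w2 z)"
        using z by (intro mult_right_mono) (cases z; auto)+
      finally show "norm (h z) \<le> norm (v2 z, w2 z)" by simp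
    qed
    moreover have cp: "continuous_on strip (\<lambda>z. (p1 z, p2 z))" by (intro continuous_intros c)
    ultimately show "\<bar>?I (\<lambda>z. (p1 z, p2 z) \<bullet> h z)\<bar> \<le> L2 \<Gamma> (\<lambda>z. (p1 z, p2 z)) * ?D"
      using integral_inner_le_L2[OF cp ch] L2_nonneg(1)[OF cp]
      by (meson mult_left_mono order_trans)
  qed simp
  finally have "\<beta> * \<bar>?I (\<lambda>z. p1 z * g2 z - p2 z * g1 z)\<bar> \<le>
      \<beta> * ((2 * L2 \<Gamma> p + L2 \<Gamma> (\<lambda>z. (p1 z, p2 z))) * ?D)"
    using \<beta> by (intro mult_left_mono) (simp_all add: distrib_right)
  then show ?thesis unfolding eq using \<beta> by (simp add: abs_mult)
qed

text \<open>
  The part of the transport by the constant flow \<open>(m, 0)\<close> is \<open>m \<integral>\<nabla>p \<bullet> \<partial>\<^sub>1u\<close>. By incompressibility this is \<open>- m\<close> times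
  the Jacobian integral of \<open>p\<close> and \<open>w\<close>, which vanishes because \<open>w\<close> does on the walls.
\<close>

lemma convective_term_bound:
  fixes p v w :: "real \<times> real \<Rightarrow> real"
  assumes \<Gamma>: "\<Gamma> > 0" and p: "has_partials p p1 p2" "periodic_x \<Gamma> p"
    and v: "has_partials v v1 v2" "periodic_x \<Gamma> v" and w: "has_partials w w1 w2" "periodic_x \<Gamma> w"
    and div: "\<And>z. z \<in> strip \<Longrightarrow> v1 z + w2 z = 0"
    and wall: "\<And>x. w (x, 0) = 0" "\<And>x. w (x, 1) = 0"
    and S: "\<And>z. z \<in> strip \<Longrightarrow> norm (v z - m, w z) \<le> S"
  shows "\<bar>integral (rect 0 \<Gamma>) (\<lambda>z. (p1 z, p2 z) \<bullet> (v z * v1 z + w z * v2 z, v z * w1 z + w z * w2 z))\<bar> \<le>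
    L2 \<Gamma> (\<lambda>z. (p1 z, p2 z)) * (S * L2 \<Gamma> (\<lambda>z. w1 z - v2 z))"
proof -
  let ?I = "integral (rect 0 \<Gamma>)" and ?G = "\<lambda>z. ((v1 z, v2 z), (w1 z, w2 z))"
  note c = has_partialsD(3-5)[OF p(1)] has_partialsD(3-5)[OF v(1)] has_partialsD(3-5)[OF w(1)]
  have S0: "S \<ge> 0" using S[of "(0, 0)"] norm_ge_zero order_trans by (metis mem_strip order_refl zero_le_one)
  define b where "b z = ((v z - m, w z) \<bullet> (v1 z, v2 z), (v z - m, w z) \<bullet> (w1 z, w2 z))" for z
  have cb: "continuous_on strip b" unfolding b_def by (intro continuous_intros c)
  have cp: "continuous_on strip (\<lambda>z. (p1 z, p2 z))" by (intro continuous_intros c)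
  have "?I (\<lambda>z. (p1 z, p2 z) \<bullet> (v z * v1 z + w z * v2 z, v z * w1 z + w z * w2 z)) =
      ?I (\<lambda>z. (p1 z, p2 z) \<bullet> b z + (- m) * (p1 z * w2 z - p2 z * w1 z))"
  proof (rule integral_cong)
    fix z assume "z \<in> rect 0 \<Gamma>"
    then have "v1 z + w2 z = 0" using div rect_subset_strip by blast
    then have "w2 z = - v1 z" by simp
    then show "(p1 z, p2 z) \<bullet> (v z * v1 z + w z * v2 z, v z * w1 z + w z * w2 z) =
        (p1 z, p2 z) \<bullet> b z + (- m) * (p1 z * w2 z - p2 z * w1 z)"
      by (simp add: b_def algebra_simps)
  qed
  also have "\<dots> = ?I (\<lambda>z. (p1 z, p2 z) \<bullet> b z) + ?I (\<lambda>z. (- m) * (p1 z * w2 z - p2 z * w1 z))"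
    by (intro integral_add integrable_on_rect continuous_intros c cb)
  also have "?I (\<lambda>z. (- m) * (p1 z * w2 z - p2 z * w1 z)) = 0"
    unfolding integral_mult_right integral_jacobian[OF \<Gamma> p w] by (simp add: wall)
  finally have eq: "?I (\<lambda>z. (p1 z, p2 z) \<bullet> (v z * v1 z + w z * v2 z, v z * w1 z + w z * w2 z)) =
      ?I (\<lambda>z. (p1 z, p2 z) \<bullet> b z)" by simp
  have "L2 \<Gamma> b \<le> L2 \<Gamma> (\<lambda>z. S *\<^sub>R ?G z)"
  proof (intro L2_mono cb continuous_intros c)
    fix z :: "real \<times> real" assume z: "z \<in> strip"
    let ?V = "(v z - m, w z)"
    have "(norm (b z))\<^sup>2 = (?V \<bullet> (v1 z, v2 z))\<^sup>2 + (?V \<bullet> (w1 z, w2 z))\<^sup>2"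
      unfolding b_def by (rule norm_pair_square)
    also have "\<dots> \<le> (norm ?V * norm (v1 z, v2 z))\<^sup>2 + (norm ?V * norm (w1 z, w2 z))\<^sup>2"
    proof -
      have "(x \<bullet> y)\<^sup>2 \<le> (norm x * norm y)\<^sup>2" for x y :: "real \<times> real"
        by (rule abs_le_square_iff[THEN iffD1]) (simp add: abs_mult Cauchy_Schwarz_ineq2)
      then show ?thesis by (intro add_mono)
    qed
    also have "\<dots> = (norm ?V * norm (?G z))\<^sup>2"
      by (simp add: power_mult_distrib distrib_left norm_prod_def[of "?G z"])
    finally have "norm (b z) \<le> norm ?V * norm (?G z)"
      by (rule power2_le_imp_le) simp
    also have "\<dots> \<le> S * norm (?G z)" by (intro mult_right_mono S z) simp
    finally show "norm (b z) \<le> norm (S *\<^sub>R ?G z)"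
      using S0 by (simp only: norm_scaleR abs_of_nonneg)
  qed
  also have "\<dots> = S * L2 \<Gamma> ?G"
    unfolding L2_def norm_scaleR power_mult_distrib integral_mult_right real_sqrt_mult using S0 by simp
  also have "L2 \<Gamma> ?G = L2 \<Gamma> (\<lambda>z. w1 z - v2 z)"
    by (rule dirichlet_eq_enstrophy[OF \<Gamma> v w div wall])
  finally have "L2 \<Gamma> b \<le> S * L2 \<Gamma> (\<lambda>z. w1 z - v2 z)" .
  then show ?thesis
    unfolding eq using integral_inner_le_L2[OF cp cb, of \<Gamma>] L2_nonneg(1)[OF cp, of \<Gamma>]
    by (meson mult_left_mono order_trans)
qed

text \<open>
  Orthogonality to \<open>\<nabla>p\<close> cannot be applied to \<open>\<partial>\<^sub>tu\<close> itself, which is merely continuous in space. But for the fixed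
  field \<open>p\<close> the integral \<open>\<integral>\<nabla>p \<bullet> u(s)\<close> vanishes at all times \<open>s > 0\<close>, and it may be differentiated in \<open>s\<close>.
\<close>

lemma time_derivative_term_zero:
  fixes u :: "real \<Rightarrow> real \<times> real \<Rightarrow> real \<times> real" and p :: "real \<times> real \<Rightarrow> real"
  assumes \<Gamma>: "\<Gamma> > 0" and p: "has_partials p p1 p2" "periodic_x \<Gamma> p"
    and u: "C1_space u" "C1_time u" "periodic \<Gamma> u" and t: "t > 0"
    and div: "\<And>s z. s > 0 \<Longrightarrow> z \<in> strip \<Longrightarrow> divergence (u s) z = 0"
    and wall: "\<And>s x. s > 0 \<Longrightarrow> snd (u s (x, 0)) = 0" "\<And>s x. s > 0 \<Longrightarrow> snd (u s (x, 1)) = 0"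
  shows "integral (rect 0 \<Gamma>) (\<lambda>z. (p1 z, p2 z) \<bullet> dt u t z) = 0"
proof -
  let ?J = "\<lambda>s. integral (rect 0 \<Gamma>) (\<lambda>z. (p1 z, p2 z) \<bullet> u s z)"
  have cp: "continuous_on strip (\<lambda>z. (p1 z, p2 z))"
    by (intro continuous_intros has_partialsD[OF p(1)])
  have J: "?J s = 0" if s: "s > 0" for s
  proof -
    note us = has_partials_C1_space[OF u(1) s]
    have "integral (rect 0 \<Gamma>) (\<lambda>z. p1 z * fst (u s z) + p2 z * snd (u s z)) = 0"
      by (rule integral_grad_orthogonal[OF \<Gamma> p has_partials_bounded_linear[OF bounded_linear_fst us] _
          has_partials_bounded_linear[OF bounded_linear_snd us]])
        (use div[OF s] wall[OF s] periodic_x_of_periodic[OF u(3) s] in \<open>auto simp: divergence_def periodic_x_def\<close>)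
    then show ?thesis by (simp add: inner_prod_def)
  qed
  have "(?J has_vector_derivative integral (rect 0 \<Gamma>) (\<lambda>z. (p1 z, p2 z) \<bullet> dt u t z)) (at t within {0<..})"
  proof (rule leibniz_rule_vector_derivative)
    fix s :: real and z assume "s \<in> {0<..}" "z \<in> rect 0 \<Gamma>"
    then have s: "s > 0" and z: "z \<in> strip" using rect_subset_strip by auto
    have "((\<lambda>s. u s z) has_vector_derivative dt u s z) (at s within {0<..})"
      using u(2) s z unfolding C1_time_def dt_def
      by (auto simp: vector_derivative_works intro: has_vector_derivative_at_within)
    then show "((\<lambda>s. (p1 z, p2 z) \<bullet> u s z) has_vector_derivative (p1 z, p2 z) \<bullet> dt u s z) (at s within {0<..})"
      by (rule bounded_linear.has_vector_derivative[OF bounded_linear_inner_right])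
  next
    fix s :: real assume "s \<in> {0<..}"
    then show "(\<lambda>z. (p1 z, p2 z) \<bullet> u s z) integrable_on rect 0 \<Gamma>"
      using has_partialsD(3)[OF has_partials_C1_space[OF u(1), of s]]
      by (intro integrable_on_rect continuous_on_inner cp) auto
  next
    have 1: "continuous_on ({0<..} \<times> rect 0 \<Gamma>) (\<lambda>w. (p1 (snd w), p2 (snd w)))"
      by (rule continuous_on_compose2[OF cp]) (use rect_subset_strip in \<open>auto intro!: continuous_intros\<close>)
    have "continuous_on ({0<..} \<times> rect 0 \<Gamma>) (\<lambda>(s, z). dt u s z)"
      by (rule continuous_on_subset[OF u(2)[unfolded C1_time_def, THEN conjunct2]])
        (intro Sigma_mono order_refl rect_subset_strip)
    then show "continuous_on ({0<..} \<times> rect 0 \<Gamma>) (\<lambda>(s, z). (p1 z, p2 z) \<bullet> dt u s z)"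
      unfolding case_prod_beta by (rule continuous_on_inner[OF 1])
  qed (use t in \<open>auto simp: convex_real_interval\<close>)
  then have "(?J has_vector_derivative integral (rect 0 \<Gamma>) (\<lambda>z. (p1 z, p2 z) \<bullet> dt u t z)) (at t)"
    by (rule has_vector_derivative_within_open[THEN iffD1, rotated 2]) (use t in auto)
  moreover have "(?J has_vector_derivative 0) (at t)"
    by (rule has_vector_derivative_transform_within_open[OF has_vector_derivative_const, where S = "{0<..}"])
      (use J t in auto)
  ultimately show ?thesis by (rule vector_derivative_unique_at)
qed

section \<open>The pressure estimate\<close>

lemma set_integral_cell:
  fixes f :: "real \<times> real \<Rightarrow> real"
  assumes "continuous_on strip f"
  shows "(LINT x:cell \<Gamma>|lebesgue. f x) = integral (rect 0 \<Gamma>) f"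
  unfolding cell_eq_rect
  by (rule set_lebesgue_integral_eq_integral(2)[OF absolutely_integrable_continuous])
    (rule continuous_on_subset[OF assms rect_subset_strip])

lemma Lnorm_eq:
  fixes f :: "real \<times> real \<Rightarrow> 'a::real_normed_vector"
  assumes "continuous_on strip f" "q > 0"
  shows "Lnorm \<Gamma> q f = integral (rect 0 \<Gamma>) (\<lambda>z. norm (f z) powr q) powr (1 / q)"
proof -
  have "continuous_on strip (\<lambda>z. norm (f z) powr q)"
    by (intro continuous_on_powr' continuous_on_norm continuous_on_const assms(1)) (use assms in auto)
  then show ?thesis by (simp add: Lnorm_def set_integral_cell)
qed

lemma Lnorm_2_eq:
  fixes f :: "real \<times> real \<Rightarrow> 'a::real_normed_vector"
  assumes "continuous_on strip f"
  shows "Lnorm \<Gamma> 2 f = L2 \<Gamma> f"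
  using L2_nonneg(2)[OF assms, of \<Gamma>] powr_half_sqrt[of "(L2 \<Gamma> f)\<^sup>2"]
  by (simp add: Lnorm_eq[OF assms] L2_def)

lemma H1norm_eq:
  assumes "has_partials p (d1 p) (d2 p)"
  shows "H1norm \<Gamma> p = sqrt ((L2 \<Gamma> p)\<^sup>2 + (L2 \<Gamma> (grad p))\<^sup>2)"
proof -
  note c = has_partialsD(3-5)[OF assms]
  have g: "continuous_on strip (grad p)"
    unfolding grad_def by (intro continuous_intros c)
  show ?thesis
    unfolding H1norm_def L2_nonneg(2)[OF c(1)] L2_nonneg(2)[OF g]
    by (subst (1 2) set_integral_cell) (auto intro!: continuous_intros c g)
qed

lemma pressure_gradient_bound:
  fixes \<Gamma> r :: real
  assumes \<Gamma>: "\<Gamma> > 0" and r: "r > 2"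
  obtains C where "C > 0"
    and "\<And>Ra Pr Ls u0 T0 u p T t. Ra > 0 \<Longrightarrow> Pr > 0 \<Longrightarrow> Ls > 0 \<Longrightarrow>
      rayleigh_benard_solution \<Gamma> Ra Pr Ls u0 T0 u p T \<Longrightarrow> integral (rect 0 \<Gamma>) (p t) = 0 \<Longrightarrow> t > 0 \<Longrightarrow>
      L2 \<Gamma> (grad (p t)) \<le> C * (inv_slip_length Ls * L2 \<Gamma> (d2 (u t))
         + 1 / Pr * L2 \<Gamma> (vorticity (u t))
             * integral (rect 0 \<Gamma>) (\<lambda>z. \<bar>vorticity (u t) z\<bar> powr r) powr (1 / r)
         + Ra * L2 \<Gamma> (T t))"
proof (rule velocity_sup_le_vorticity[OF \<Gamma> r])
  fix C assume C: "C > 0" and sup: "\<And>v v1 v2 w w1 w2. has_partials v v1 v2 \<Longrightarrow> periodic_x \<Gamma> v \<Longrightarrow>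
      has_partials w w1 w2 \<Longrightarrow> periodic_x \<Gamma> w \<Longrightarrow> (\<And>z. z \<in> strip \<Longrightarrow> v1 z + w2 z = 0) \<Longrightarrow>
      (\<And>x. w (x, 0) = 0) \<Longrightarrow> (\<And>x. w (x, 1) = 0) \<Longrightarrow>
      \<exists>m. \<forall>z\<in>strip. norm (v z - m, w z) \<le>
        C * integral (rect 0 \<Gamma>) (\<lambda>z. \<bar>w1 z - v2 z\<bar> powr r) powr (1 / r)"
  define c where "c = sqrt (2 * \<Gamma>\<^sup>2 + 2)"
  have c0: "c \<ge> 0" by (simp add: c_def)
  let ?C = "2 * c + 1 + C"
  show thesis
  proof (rule that)
    show "?C > 0" using c0 C by simp
    fix Ra Pr Ls u0 T0 u p T t
    assume Ra: "Ra > 0" and Pr: "Pr > 0" and Ls: "Ls > (0 :: ereal)"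
      and sol: "rayleigh_benard_solution \<Gamma> Ra Pr Ls u0 T0 u p T"
      and mean: "integral (rect 0 \<Gamma>) (p t) = 0" and t: "t > 0"
    let ?I = "integral (rect 0 \<Gamma>)"
    define \<beta> where "\<beta> = inv_slip_length Ls"
    have \<beta>: "\<beta> \<ge> 0"
      using Ls by (cases Ls) (auto simp: \<beta>_def inv_slip_length_def)
    note sol' = sol[unfolded rayleigh_benard_solution_def]
    have u: "C1_time u" "C2_space u" "periodic \<Gamma> u" and p: "C1_space p" "periodic \<Gamma> p" and T: "C2_space T"
      using sol' by blast+
    have u1: "C1_space u" and u2: "C1_space (\<lambda>t. d1 (u t))" "C1_space (\<lambda>t. d2 (u t))"
      using u(2) by (simp_all add: C2_space_def)
    have pde: "(1 / Pr) *\<^sub>R (dt u s z + advect (u s) (u s) z) - laplacian (u s) z + grad (p s) z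
        = (Ra * T s z) *\<^sub>R (0, 1)" "divergence (u s) z = 0" if "s > 0" "z \<in> strip" for s z
      using sol' that by blast+
    have bc: "snd (u s (x, 1)) = 0" "snd (u s (x, 0)) = 0"
      "fst (d2 (u s) (x, 1)) = - \<beta> * fst (u s (x, 1))" "fst (d2 (u s) (x, 0)) = \<beta> * fst (u s (x, 0))"
      if "s > 0" for s x
      using sol' that unfolding \<beta>_def by blast+
    note hp = has_partials_C1_space[OF p(1) t] and pp = periodic_x_of_periodic[OF p(2) t]
    note hu = has_partials_C1_space[OF u1 t] and pu = periodic_x_of_periodic[OF u(3) t]
    note hu1 = has_partials_C1_space[OF u2(1) t] and hu2 = has_partials_C1_space[OF u2(2) t]
    note fstp = has_partials_bounded_linear[OF bounded_linear_fst]
    note sndp = has_partials_bounded_linear[OF bounded_linear_snd]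
    have pfst: "periodic_x \<Gamma> (\<lambda>z. fst (u t z))" and psnd: "periodic_x \<Gamma> (\<lambda>z. snd (u t z))"
      using pu by (auto simp: periodic_x_def)
    have div: "fst (d1 (u t) z) + snd (d2 (u t) z) = 0" if "z \<in> strip" for z
      using pde(2)[OF t that] by (simp add: divergence_def)
    have cT: "continuous_on strip (T t)"
      using T has_partialsD(3)[OF has_partials_C1_space[OF _ t]] by (auto simp: C2_space_def)
    have cdt: "continuous_on strip (dt u t)"
    proof -
      have "continuous_on strip (\<lambda>x. case (t, x) of (t, x) \<Rightarrow> dt u t x)"
        by (rule continuous_on_compose2[OF u(1)[unfolded C1_time_def, THEN conjunct2]])
          (use t in \<open>auto intro!: continuous_intros\<close>)
      then show ?thesis by simp
    qed
    note cu = has_partialsD(3-5)[OF hu] has_partialsD(3-5)[OF hu1] has_partialsD(3-5)[OF hu2]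
    define W where "W = ?I (\<lambda>z. \<bar>vorticity (u t) z\<bar> powr r) powr (1 / r)"
    define \<Omega> where "\<Omega> = L2 \<Gamma> (vorticity (u t))"
    define G where "G = L2 \<Gamma> (grad (p t))"
    define D where "D = L2 \<Gamma> (d2 (u t))"
    define \<Theta> where "\<Theta> = L2 \<Gamma> (T t)"
    have cg: "continuous_on strip (grad (p t))"
      unfolding grad_def by (intro continuous_intros has_partialsD[OF hp])
    have c\<omega>: "continuous_on strip (vorticity (u t))"
      unfolding vorticity_def by (intro continuous_intros cu)
    have nn: "W \<ge> 0" "\<Omega> \<ge> 0" "G \<ge> 0" "D \<ge> 0" "\<Theta> \<ge> 0"
      unfolding W_def \<Omega>_def G_def D_def \<Theta>_def by (auto intro!: L2_nonneg(1) c\<omega> cg cu cT)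
    have gradz: "(d1 (p t) z, d2 (p t) z) = grad (p t) z" for z
      by (simp add: grad_def)
    have vortz: "snd (d1 (u t) z) - fst (d2 (u t) z) = vorticity (u t) z" for z
      by (simp add: vorticity_def)
    have pL2: "L2 \<Gamma> (p t) \<le> c * G"
      using Poincare_L2[OF \<Gamma> hp mean] by (simp only: gradz c_def G_def)

    have visc: "\<bar>?I (\<lambda>z. grad (p t) z \<bullet> laplacian (u t) z)\<bar> \<le> \<beta> * ((2 * L2 \<Gamma> (p t) + G) * D)"
    proof -
      have lapz: "(fst (d1 (d1 (u t)) z) + fst (d2 (d2 (u t)) z), snd (d1 (d1 (u t)) z) + snd (d2 (d2 (u t)) z))
          = laplacian (u t) z" for z
        by (simp add: laplacian_def prod_eq_iff)
      show ?thesis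
        using viscous_term_bound[OF \<Gamma> \<beta> hp pp fstp[OF hu] pfst sndp[OF hu] psnd fstp[OF hu1] fstp[OF hu2]
            sndp[OF hu1] sndp[OF hu2] div bc(2)[OF t] bc(1)[OF t] bc(4)[OF t] bc(3)[OF t]]
        by (simp only: gradz lapz prod.collapse G_def D_def)
    qed
    have conv: "\<bar>?I (\<lambda>z. grad (p t) z \<bullet> advect (u t) (u t) z)\<bar> \<le> G * (C * W * \<Omega>)"
    proof -
      obtain m where m: "\<And>z. z \<in> strip \<Longrightarrow> norm (fst (u t z) - m, snd (u t z)) \<le> C * W"
        using sup[OF fstp[OF hu] pfst sndp[OF hu] psnd div bc(2)[OF t] bc(1)[OF t]]
        unfolding W_def vortz by blast
      have advz: "(fst (u t z) * fst (d1 (u t) z) + snd (u t z) * fst (d2 (u t) z),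
          fst (u t z) * snd (d1 (u t) z) + snd (u t z) * snd (d2 (u t) z)) = advect (u t) (u t) z" for z
        by (simp add: advect_def prod_eq_iff)
      show ?thesis
        using convective_term_bound[OF \<Gamma> hp pp fstp[OF hu] pfst sndp[OF hu] psnd div bc(2)[OF t] bc(1)[OF t] m]
        by (simp only: gradz vortz advz G_def \<Omega>_def)
    qed
    have time: "?I (\<lambda>z. grad (p t) z \<bullet> dt u t z) = 0"
      using time_derivative_term_zero[OF \<Gamma> hp pp u1 u(1) u(3) t pde(2) bc(2) bc(1)]
      by (simp only: gradz)
    have buoy: "\<bar>?I (\<lambda>z. grad (p t) z \<bullet> (T t z *\<^sub>R (0, 1)))\<bar> \<le> G * \<Theta>"
    proof -
      have "L2 \<Gamma> (\<lambda>z. T t z *\<^sub>R (0 :: real, 1 :: real)) = \<Theta>"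
        unfolding L2_def \<Theta>_def by (simp add: norm_prod_def)
      moreover have "continuous_on strip (\<lambda>z. T t z *\<^sub>R (0 :: real, 1 :: real))"
        by (intro continuous_on_scaleR cT continuous_on_const)
      note integral_inner_le_L2[OF cg this, of \<Gamma>]
      ultimately show ?thesis unfolding G_def by (simp only:)
    qed

    have "G\<^sup>2 = ?I (\<lambda>z. grad (p t) z \<bullet> grad (p t) z)"
      unfolding G_def L2_nonneg(2)[OF cg] by (simp add: power2_norm_eq_inner)
    also have "\<dots> = ?I (\<lambda>z. grad (p t) z \<bullet> laplacian (u t) z
        + (Ra * (grad (p t) z \<bullet> (T t z *\<^sub>R (0, 1)))
          - (1 / Pr) * (grad (p t) z \<bullet> dt u t z + grad (p t) z \<bullet> advect (u t) (u t) z)))"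
    proof (rule integral_cong)
      fix z assume "z \<in> rect 0 \<Gamma>"
      then have z: "z \<in> strip" using rect_subset_strip by blast
      have "grad (p t) z = laplacian (u t) z + (Ra *\<^sub>R (T t z *\<^sub>R (0, 1))
          - (1 / Pr) *\<^sub>R (dt u t z + advect (u t) (u t) z))"
        using pde(1)[OF t z] by (simp add: algebra_simps)
      from arg_cong[OF this, of "\<lambda>a. grad (p t) z \<bullet> a"]
      show "grad (p t) z \<bullet> grad (p t) z = grad (p t) z \<bullet> laplacian (u t) z
          + (Ra * (grad (p t) z \<bullet> (T t z *\<^sub>R (0, 1)))
            - (1 / Pr) * (grad (p t) z \<bullet> dt u t z + grad (p t) z \<bullet> advect (u t) (u t) z))"
        by (simp only: inner_add_right inner_diff_right inner_scaleR_right)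
    qed
    also have "\<dots> = ?I (\<lambda>z. grad (p t) z \<bullet> laplacian (u t) z)
        + (Ra * ?I (\<lambda>z. grad (p t) z \<bullet> (T t z *\<^sub>R (0, 1)))
          - (1 / Pr) * (?I (\<lambda>z. grad (p t) z \<bullet> dt u t z) + ?I (\<lambda>z. grad (p t) z \<bullet> advect (u t) (u t) z)))"
    proof -
      have cl: "continuous_on strip (laplacian (u t))" and ca: "continuous_on strip (advect (u t) (u t))"
        unfolding laplacian_def advect_def by (intro continuous_intros cu)+
      have lin: "?I (\<lambda>z. f z + (a * g z - b * (h z + k z))) = ?I f + (a * ?I g - b * (?I h + ?I k))"
        if "continuous_on strip f" "continuous_on strip g" "continuous_on strip h" "continuous_on strip k"
        for f g h k :: "real \<times> real \<Rightarrow> real" and a b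
        by (rule integral_unique)
          (intro has_integral_add has_integral_diff has_integral_mult_right integrable_integral
            integrable_on_rect that)
      show ?thesis
        by (rule lin) (intro continuous_intros cg cl ca cdt cT)+
    qed
    also have "\<dots> \<le> \<beta> * ((2 * L2 \<Gamma> (p t) + G) * D) + (Ra * (G * \<Theta>) + (1 / Pr) * (G * (C * W * \<Omega>)))"
    proof -
      have "Ra * ?I (\<lambda>z. grad (p t) z \<bullet> (T t z *\<^sub>R (0, 1))) \<le> Ra * (G * \<Theta>)"
        using buoy Ra by (intro mult_left_mono) auto
      moreover have "(1 / Pr) * (- ?I (\<lambda>z. grad (p t) z \<bullet> advect (u t) (u t) z)) \<le> (1 / Pr) * (G * (C * W * \<Omega>))"
        using conv Pr by (intro mult_left_mono) auto
      ultimately show ?thesis using visc unfolding time by (simp only: mult_minus_right add_0)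
    qed
    also have "\<dots> \<le> G * (?C * (\<beta> * D + 1 / Pr * \<Omega> * W + Ra * \<Theta>))"
    proof -
      have "\<beta> * ((2 * L2 \<Gamma> (p t) + G) * D) \<le> \<beta> * ((2 * (c * G) + G) * D)"
        using pL2 \<beta> nn by (intro mult_left_mono mult_right_mono add_right_mono) auto
      also have "\<dots> = G * ((2 * c + 1) * (\<beta> * D))" by (simp add: algebra_simps)
      also have "\<dots> \<le> G * (?C * (\<beta> * D))"
        using nn \<beta> C by (intro mult_left_mono mult_right_mono) auto
      finally have 1: "\<beta> * ((2 * L2 \<Gamma> (p t) + G) * D) \<le> G * (?C * (\<beta> * D))" .
      have "Ra * (G * \<Theta>) = G * (1 * (Ra * \<Theta>))" by simp
      also have "\<dots> \<le> G * (?C * (Ra * \<Theta>))"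
        using nn Ra C c0 by (intro mult_left_mono mult_right_mono) auto
      finally have 2: "Ra * (G * \<Theta>) \<le> G * (?C * (Ra * \<Theta>))" .
      have "(1 / Pr) * (G * (C * W * \<Omega>)) = G * (C * (1 / Pr * \<Omega> * W))" by simp
      also have "\<dots> \<le> G * (?C * (1 / Pr * \<Omega> * W))"
        using nn Pr C c0 by (intro mult_left_mono mult_right_mono) auto
      finally have 3: "(1 / Pr) * (G * (C * W * \<Omega>)) \<le> G * (?C * (1 / Pr * \<Omega> * W))" .
      show ?thesis using 1 2 3 unfolding distrib_left[of ?C] distrib_left[of G] by linarith
    qed
    finally have "G * G \<le> G * (?C * (\<beta> * D + 1 / Pr * \<Omega> * W + Ra * \<Theta>))"
      by (simp add: power2_eq_square)
    moreover have "0 \<le> ?C * (\<beta> * D + 1 / Pr * \<Omega> * W + Ra * \<Theta>)"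
      using nn \<beta> Pr Ra C c0 by (intro mult_nonneg_nonneg add_nonneg_nonneg) auto
    ultimately have "G \<le> ?C * (\<beta> * D + 1 / Pr * \<Omega> * W + Ra * \<Theta>)"
      using nn(3) by (cases "G = 0") auto
    then show "L2 \<Gamma> (grad (p t)) \<le> ?C * (inv_slip_length Ls * L2 \<Gamma> (d2 (u t))
         + 1 / Pr * L2 \<Gamma> (vorticity (u t)) * ?I (\<lambda>z. \<bar>vorticity (u t) z\<bar> powr r) powr (1 / r)
         + Ra * L2 \<Gamma> (T t))"
      unfolding G_def D_def W_def \<Omega>_def \<Theta>_def \<beta>_def .
  qed
qed

theorem lemma5:
  fixes \<Gamma> r :: real
  assumes "\<Gamma> > 0" and "r > 2"
  shows "\<exists>C>0. \<forall>(Ra::real) (Pr::real) (Ls::ereal) u0 T0 u p T.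
    Ra > 0 \<longrightarrow> Pr > 0 \<longrightarrow> Ls > 0 \<longrightarrow>
    rayleigh_benard_solution \<Gamma> Ra Pr Ls u0 T0 u p T \<longrightarrow>
    (\<forall>t>0. (LINT x:cell \<Gamma>|lebesgue. p t x) = 0) \<longrightarrow>
    (\<forall>t>0. H1norm \<Gamma> (p t) \<le>
      C * (inv_slip_length Ls * Lnorm \<Gamma> 2 (d2 (u t))
         + 1 / Pr * Lnorm \<Gamma> 2 (vorticity (u t)) * Lnorm \<Gamma> r (vorticity (u t))
         + Ra * Lnorm \<Gamma> 2 (T t)))"
proof (rule pressure_gradient_bound[OF assms])
  fix C assume C: "C > 0" and grad: "\<And>Ra Pr Ls u0 T0 u p T t. Ra > 0 \<Longrightarrow> Pr > 0 \<Longrightarrow> Ls > 0 \<Longrightarrow>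
      rayleigh_benard_solution \<Gamma> Ra Pr Ls u0 T0 u p T \<Longrightarrow> integral (rect 0 \<Gamma>) (p t) = 0 \<Longrightarrow> t > 0 \<Longrightarrow>
      L2 \<Gamma> (grad (p t)) \<le> C * (inv_slip_length Ls * L2 \<Gamma> (d2 (u t))
         + 1 / Pr * L2 \<Gamma> (vorticity (u t))
             * integral (rect 0 \<Gamma>) (\<lambda>z. \<bar>vorticity (u t) z\<bar> powr r) powr (1 / r)
         + Ra * L2 \<Gamma> (T t))"
  define c where "c = sqrt (2 * \<Gamma>\<^sup>2 + 2)"
  show ?thesis
  proof (intro exI[of _ "sqrt (c\<^sup>2 + 1) * C"] conjI allI impI)
    show "sqrt (c\<^sup>2 + 1) * C > 0" using C by (simp add: add_nonneg_pos)
    fix Ra Pr :: real and Ls :: ereal and u0 T0 u p T and t :: real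
    assume Ra: "Ra > 0" and Pr: "Pr > 0" and Ls: "Ls > 0"
      and sol: "rayleigh_benard_solution \<Gamma> Ra Pr Ls u0 T0 u p T"
      and mean: "\<forall>t>0. (LINT x:cell \<Gamma>|lebesgue. p t x) = 0" and t: "t > 0"
    have sp: "C1_space u" "C1_space T" "C1_space p"
      using sol by (auto simp: rayleigh_benard_solution_def C2_space_def)
    note hp = has_partials_C1_space[OF sp(3) t] and hu = has_partials_C1_space[OF sp(1) t]
    have c\<omega>: "continuous_on strip (vorticity (u t))"
      unfolding vorticity_def by (intro continuous_intros has_partialsD[OF hu])
    have cg: "continuous_on strip (grad (p t))"
      unfolding grad_def by (intro continuous_intros has_partialsD[OF hp])
    have mean': "integral (rect 0 \<Gamma>) (p t) = 0"
      using mean t set_integral_cell[OF has_partialsD(3)[OF hp], of \<Gamma>] by simp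
    have "L2 \<Gamma> (p t) \<le> c * L2 \<Gamma> (grad (p t))"
      using Poincare_L2[OF assms(1) hp mean'] by (simp add: c_def grad_def[abs_def])
    then have "(L2 \<Gamma> (p t))\<^sup>2 \<le> (c * L2 \<Gamma> (grad (p t)))\<^sup>2"
      by (rule power_mono) (rule L2_nonneg(1)[OF has_partialsD(3)[OF hp]])
    then have "H1norm \<Gamma> (p t) \<le> sqrt ((c\<^sup>2 + 1) * (L2 \<Gamma> (grad (p t)))\<^sup>2)"
      unfolding H1norm_eq[OF hp] by (simp add: power_mult_distrib distrib_right)
    also have "\<dots> = sqrt (c\<^sup>2 + 1) * L2 \<Gamma> (grad (p t))"
      using L2_nonneg(1)[OF cg] by (simp add: real_sqrt_mult)
    also have "\<dots> \<le> sqrt (c\<^sup>2 + 1) * (C * (inv_slip_length Ls * L2 \<Gamma> (d2 (u t))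
         + 1 / Pr * L2 \<Gamma> (vorticity (u t))
             * integral (rect 0 \<Gamma>) (\<lambda>z. \<bar>vorticity (u t) z\<bar> powr r) powr (1 / r)
         + Ra * L2 \<Gamma> (T t)))"
      by (intro mult_left_mono grad[OF Ra Pr Ls sol mean' t]) simp
    finally show "H1norm \<Gamma> (p t) \<le> sqrt (c\<^sup>2 + 1) * C * (inv_slip_length Ls * Lnorm \<Gamma> 2 (d2 (u t))
         + 1 / Pr * Lnorm \<Gamma> 2 (vorticity (u t)) * Lnorm \<Gamma> r (vorticity (u t))
         + Ra * Lnorm \<Gamma> 2 (T t))"
      using assms(2) Lnorm_eq[OF c\<omega>, of r \<Gamma>]
      by (simp add: Lnorm_2_eq c\<omega> has_partialsD(5)[OF hu] has_partialsD(3)[OF has_partials_C1_space[OF sp(2) t]]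
          mult.assoc)
  qed
qed

end
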